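(* Consider a Thurstone choice model with noise distribution $F$ and true parameter $\theta^\star\in\Theta_b$, and a fixed (deterministic) sequence of $m$ comparison sets $S_1,\dots,S_m$, each of cardinality $2$. Assume: (P1) there is $A>0$ with $\frac{d^2}{dx^2}\log p_2(x)\le -A$ for all $x\in[-2b,2b]$; (P2) there is $B>0$ with $\left|\frac{d}{dx}\log p_2(x)\right|\le B$ for all $x\in[-2b,2b]$; (P3) $\lambda_2(L_{M})>0$. Let $\widehat\theta\in\arg\max_{\theta\in\Theta_b}\ell(\theta)$ be the maximum likelihood estimator. Then, with probability at least $1-2/n$ (over the random choices), $$\mathrm{MSE}(\widehat\theta,\theta^\star)\le D^2\,\frac{n(\log n+2)}{\lambda_2(L_{M_{1/4}})^2}\,\frac1m,\qquad D=B/A.$$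
   Context: Items are $N=\{1,\dots,n\}$. Data: $m$ observations $(S_t,y_t)$, $t=1,\dots,m$, with $S_t\subseteq N$ a comparison set and $y_t\in S_t$ the chosen item. A Thurstone choice model is specified by a cumulative distribution function $F$ of a zero-mean random variable with density $f$. For $k\ge2$ and $x\in\mathbb R^{k-1}$, $p_k(x)=\int_{\mathbb R}\big(\prod_{v=1}^{k-1}F(x_v+z)\big)f(z)\,dz$; in particular $p_2(x)=\int_{\mathbb R}F(x+z)f(z)\,dz$. For $S\subseteq N$ with $|S|=k$ and $i\in S$, $p_{i,S}(\theta)=p_k(x_{i,S}(\theta))$, where $x_{i,S}(\theta)\in\mathbb R^{k-1}$ has entries $\theta_i-\theta_j$, $j\in S\setminus\{i\}$. Given the comparison sets, choices are independent with $\Pr[y_t=i]=p_{i,S_t}(\theta^\star)$. For $b>0$, $\Theta_b=\{\theta\in[-b,b]^n:\sum_i\theta_i=0\}$. Log-likelihood: $\ell(\theta)=\sum_{t=1}^m\log p_{y_t,S_t}(\theta)$. $\mathrm{MSE}(\widehat\theta,\theta^\star)=\frac1n\|\widehat\theta-\theta^\star\|_2^2$. Weighted-adjacency matrix: for a weight function $w:\{2,3,\dots\}\to\mathbb R_+$, $M_w\in\mathbb R^{n\times n}$ has zero diagonal and off-diagonal entries $m_{ij}=\frac nm\sum_{k\ge2}w(k)\,m_{ij}(k)$, where $m_{ij}(k)$ is the number of $t$ with $|S_t|=k$ and $\{i,j\}\subseteq S_t$; $M_a$ denotes $M_w$ for the constant weight $w\equiv a$, and $M=M_1$. Laplacian: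 $L_A=\mathrm{diag}(A\mathbf 1)-A$. Eigenvalues of symmetric matrices are ordered $\lambda_1\le\dots\le\lambda_n$. *)

theory Defs
  imports "HOL-Probability.Probability" "Jordan_Normal_Form.Char_Poly"
begin

definition thurstone_noise :: "(real \<Rightarrow> real) \<Rightarrow> (real \<Rightarrow> real) \<Rightarrow> bool" where
  "thurstone_noise F f \<longleftrightarrow>
     f \<in> borel_measurable lborel \<and> (\<forall>x. 0 \<le> f x) \<and>
     integrable lborel f \<and> (\<integral>z. f z \<partial>lborel) = 1 \<and>
     integrable lborel (\<lambda>z. z * f z) \<and> (\<integral>z. z * f z \<partial>lborel) = 0 \<and>
     (\<forall>x. F x = (\<integral>z. indicator {..x} z * f z \<partial>lborel))"

definition p2 :: "(real \<Rightarrow> real) \<Rightarrow> (real \<Rightarrow> real) \<Rightarrow> real \<Rightarrow> real" where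
  "p2 F f x = (\<integral>z. F (x + z) * f z \<partial>lborel)"

definition p_choice :: "(real \<Rightarrow> real) \<Rightarrow> (real \<Rightarrow> real) \<Rightarrow> (nat \<Rightarrow> real) \<Rightarrow> nat \<Rightarrow> nat set \<Rightarrow> real" where
  "p_choice F f \<theta> i S = (\<integral>z. (\<Prod>j\<in>S - {i}. F (\<theta> i - \<theta> j + z)) * f z \<partial>lborel)"

definition choice_pmf :: "(real \<Rightarrow> real) \<Rightarrow> (real \<Rightarrow> real) \<Rightarrow> (nat \<Rightarrow> real) \<Rightarrow> nat set \<Rightarrow> nat pmf" where
  "choice_pmf F f \<theta> S = embed_pmf (\<lambda>i. if i \<in> S then p_choice F f \<theta> i S else 0)"

definition choices_pmf :: "(real \<Rightarrow> real) \<Rightarrow> (real \<Rightarrow> real) \<Rightarrow> (nat \<Rightarrow> real) \<Rightarrow> nat \<Rightarrow> (nat \<Rightarrow> nat set) \<Rightarrow> (nat \<Rightarrow> nat) pmf" where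
  "choices_pmf F f \<theta> m S = Pi_pmf {..<m} 0 (\<lambda>t. choice_pmf F f \<theta> (S t))"

definition Theta :: "nat \<Rightarrow> real \<Rightarrow> (nat \<Rightarrow> real) set" where
  "Theta n b = {\<theta>. (\<forall>i<n. \<bar>\<theta> i\<bar> \<le> b) \<and> (\<forall>i\<ge>n. \<theta> i = 0) \<and> (\<Sum>i<n. \<theta> i) = 0}"

definition loglik :: "(real \<Rightarrow> real) \<Rightarrow> (real \<Rightarrow> real) \<Rightarrow> nat \<Rightarrow> (nat \<Rightarrow> nat set) \<Rightarrow> (nat \<Rightarrow> nat) \<Rightarrow> (nat \<Rightarrow> real) \<Rightarrow> real" where
  "loglik F f m S y \<theta> = (\<Sum>t<m. ln (p_choice F f \<theta> (y t) (S t)))"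

definition MSE :: "nat \<Rightarrow> (nat \<Rightarrow> real) \<Rightarrow> (nat \<Rightarrow> real) \<Rightarrow> real" where
  "MSE n \<theta>1 \<theta>2 = (1 / real n) * (\<Sum>i<n. (\<theta>1 i - \<theta>2 i)\<^sup>2)"

definition mcount :: "nat \<Rightarrow> (nat \<Rightarrow> nat set) \<Rightarrow> nat \<Rightarrow> nat \<Rightarrow> nat \<Rightarrow> nat" where
  "mcount m S i j k = card {t. t < m \<and> card (S t) = k \<and> {i, j} \<subseteq> S t}"

text \<open>Weighted adjacency matrix M_w (k ranges over 2..n since S_t is a subset of the n items).\<close>
definition M_w :: "nat \<Rightarrow> nat \<Rightarrow> (nat \<Rightarrow> nat set) \<Rightarrow> (nat \<Rightarrow> real) \<Rightarrow> real mat" where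
  "M_w n m S w = Matrix.mat n n (\<lambda>(i, j). if i = j then 0
      else real n / real m * (\<Sum>k\<in>{2..n}. w k * real (mcount m S i j k)))"

definition laplacian :: "real mat \<Rightarrow> real mat" where
  "laplacian A = Matrix.mat (dim_row A) (dim_row A)
      (\<lambda>(i, j). (if i = j then (\<Sum>k<dim_col A. A $$ (i, k)) else 0) - A $$ (i, j))"

definition eigenvalues_sorted :: "real mat \<Rightarrow> real list" where
  "eigenvalues_sorted A = sorted_list_of_multiset (proots (char_poly A))"

definition lambda_k :: "nat \<Rightarrow> real mat \<Rightarrow> real" where
  "lambda_k k A = eigenvalues_sorted A ! (k - 1)"

end

theory Submission
  imports Defs
begin

text \<open>
  For \<open>S\<^sub>t = {i, j}\<close> let \<open>u\<^sub>t = e\<^sub>i - e\<^sub>j\<close>. The score at the true parameter is \<open>X = \<Sum>\<^sub>t \<xi>\<^sub>t u\<^sub>t\<close> with independent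
  coefficients \<open>\<xi>\<^sub>t\<close> that are bounded by \<open>B\<close> and, since \<open>p\<^sub>2(x) + p\<^sub>2(-x) = 1\<close>, centred. The first-order
  condition at the maximum likelihood estimator, combined with the strong concavity of \<open>ln p\<^sub>2\<close>, gives
  \<open>A \<Sum>\<^sub>t \<langle>u\<^sub>t, \<Delta>\<rangle>\<^sup>2 \<le> \<langle>X, \<Delta>\<rangle>\<close> for the error \<open>\<Delta>\<close>. The left-hand side is \<open>A (m/n)\<close> times the quadratic form of
  \<open>L\<^sub>M\<close>, hence at least \<open>4 A (m/n) \<lambda>\<^sub>2 |\<Delta>|\<^sup>2\<close> with \<open>\<lambda>\<^sub>2\<close> the second eigenvalue for the weight 1/4, and
  Cauchy-Schwarz bounds \<open>|\<Delta>|\<close> by \<open>n |X| / (4 A m \<lambda>\<^sub>2)\<close>. Finally \<open>|X|\<^sup>2 \<le> 16 m B\<^sup>2 (ln n + 2)\<close> outside an event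
  of probability at most \<open>2/n\<close>, because \<open>E exp(|X|\<^sup>2 / (8 m B\<^sup>2)) \<le> \<surd>e\<close>; this moment bound follows by
  adding the summands one at a time and applying Hoeffding's lemma to each.
\<close>

subsection \<open>The second smallest eigenvalue\<close>

unbundle no vec_syntax

text \<open>Were the entry at index 1 above \<open>c\<close>, sortedness would put all later ones
  above \<open>c\<close> too, leaving at most the head to be counted.\<close>

lemma sorted_list_nth_1_le:
  fixes X :: "real multiset"
  assumes "2 \<le> size {#x \<in># X. x \<le> c#}"
  shows "sorted_list_of_multiset X ! 1 \<le> c"
proof (rule ccontr)
  define xs where "xs = sorted_list_of_multiset X"
  have sx: "sorted xs" and mx: "mset xs = X" by (auto simp: xs_def)
  assume "\<not> sorted_list_of_multiset X ! 1 \<le> c"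
  hence gt: "xs ! 1 > c" by (simp add: xs_def)
  have fl: "size {#x \<in># X. x \<le> c#} = length (filter (\<lambda>x. x \<le> c) xs)"
    using mx by (metis mset_filter size_mset)
  have "filter (\<lambda>x. x \<le> c) (drop 1 xs) = []"
  proof -
    have "\<not> x \<le> c" if x: "x \<in> set (drop 1 xs)" for x
    proof -
      obtain i where i: "i < length (drop 1 xs)" "x = drop 1 xs ! i"
        using x by (metis in_set_conv_nth)
      hence "xs ! 1 \<le> xs ! (1 + i)" using sx by (auto intro!: sorted_nth_mono)
      with i gt show ?thesis by auto
    qed
    thus ?thesis by (simp add: filter_empty_conv)
  qed
  hence "filter (\<lambda>x. x \<le> c) xs = filter (\<lambda>x. x \<le> c) (take 1 xs)"
    by (metis append_Nil2 append_take_drop_id filter_append)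
  hence "length (filter (\<lambda>x. x \<le> c) xs) \<le> length (take 1 xs)"
    by (metis length_filter_le)
  with assms fl show False by simp
qed

text \<open>\<open>lambda_k 2\<close> reads list index 1, so two roots at or below \<open>c\<close>,
  counted with multiplicity, suffice. They will be either distinct or one double root.\<close>

lemma lambda_2_le:
  assumes "2 \<le> size {#x \<in># proots (char_poly A). x \<le> c#}"
  shows "lambda_k 2 A \<le> c"
  using sorted_list_nth_1_le[OF assms] by (simp add: lambda_k_def eigenvalues_sorted_def)

lemma char_poly_nonzero:
  fixes A :: "real mat"
  assumes "A \<in> carrier_mat n n"
  shows "char_poly A \<noteq> 0"
  using degree_monic_char_poly[OF assms] by auto

lemma two_le_size_filter:
  assumes "a \<in># X" "b \<in># X" "a \<noteq> b" "P a" "P b"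
  shows "2 \<le> size (filter_mset P X)"
proof -
  have "{#a, b#} \<subseteq># filter_mset P X"
    using assms by (auto simp: insert_subset_eq_iff in_diff_count)
  from size_mset_mono[OF this] show ?thesis by simp
qed

lemma lambda_2_le_of_two_eigenvalues:
  fixes A :: "real mat"
  assumes A: "A \<in> carrier_mat n n" and "eigenvalue A a" "eigenvalue A b" "a \<noteq> b" "a \<le> c" "b \<le> c"
  shows "lambda_k 2 A \<le> c"
  using assms eigenvalue_root_char_poly[OF A] char_poly_nonzero[OF A]
  by (intro lambda_2_le two_le_size_filter[of a _ b]) auto

lemma lambda_2_le_of_double_root:
  fixes A :: "real mat"
  assumes A: "A \<in> carrier_mat n n" and d: "[:- c, 1:] ^ 2 dvd char_poly A"
  shows "lambda_k 2 A \<le> c"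
proof -
  have "2 \<le> order c (char_poly A)"
    using order_divides[of c 2 "char_poly A"] d char_poly_nonzero[OF A] by auto
  hence "2 \<le> count (proots (char_poly A)) c" using char_poly_nonzero[OF A] by simp
  hence "replicate_mset 2 c \<subseteq># {#x \<in># proots (char_poly A). x \<le> c#}"
    by (auto simp: count_le_replicate_mset_subset_eq[symmetric])
  from size_mset_mono[OF this] show ?thesis by (intro lambda_2_le) simp
qed

text \<open>By Cramer's rule, putting an eigenvector in place of a column of the characteristic matrix
  multiplies the determinant by a constant and exposes a linear factor; two independent eigenvectors
  can be used in two different columns.\<close>
lemma double_root_of_two_eigenvectors:
  fixes A :: "real mat" and v w :: "real Matrix.vec"
  assumes A: "A \<in> carrier_mat n n" and v: "v \<in> carrier_vec n" and w: "w \<in> carrier_vec n"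
    and Av: "A *\<^sub>v v = c \<cdot>\<^sub>v v" and Aw: "A *\<^sub>v w = c \<cdot>\<^sub>v w"
    and jk: "j < n" "k < n" "j \<noteq> k" and nz: "v $ j \<noteq> 0" "w $ k \<noteq> 0" "w $ j = 0"
  shows "[:- c, 1:] ^ 2 dvd char_poly A"
proof -
  define p where "p = [:- c, 1:]"
  define N where "N = char_poly_matrix A"
  have N: "N \<in> carrier_mat n n" using A by (simp add: N_def)
  define V where "V = map_vec (\<lambda>a. [:a:]) v"
  define W where "W = map_vec (\<lambda>a. [:a:]) w"
  have VW: "V \<in> carrier_vec n" "W \<in> carrier_vec n" using v w by (auto simp: V_def W_def)
  \<comment> \<open>The characteristic matrix is \<open>X I - A\<close>, so it sends a constant
    eigenvector for \<open>c\<close> to \<open>X - c\<close> times itself.\<close>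
  have eig: "(N *\<^sub>v map_vec (\<lambda>a. [:a:]) z) $ i = p * [:z $ i:]"
    if z: "z \<in> carrier_vec n" "A *\<^sub>v z = c \<cdot>\<^sub>v z" and i: "i < n" for z i
  proof -
    have e: "(\<Sum>l<n. A $$ (i, l) * z $ l) = c * z $ i"
      using arg_cong[OF z(2), of "\<lambda>x. x $ i"] A z(1) i
      by (simp add: scalar_prod_def lessThan_atLeast0)
    have "(N *\<^sub>v map_vec (\<lambda>a. [:a:]) z) $ i =
        (\<Sum>l<n. (if i = l then [:0, 1:] * [:z $ l:] else 0) - [:A $$ (i, l) * z $ l:])"
      using N A z i
      by (simp add: scalar_prod_def lessThan_atLeast0 N_def char_poly_matrix_def)
         (rule sum.cong, auto simp: algebra_simps)
    also have "\<dots> = (\<Sum>l<n. if i = l then [:0, 1:] * [:z $ l:] else 0) - (\<Sum>l<n. [:A $$ (i, l) * z $ l:])"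
      by (rule sum_subtractf)
    also have "(\<Sum>l<n. [:A $$ (i, l) * z $ l:]) = [:\<Sum>l<n. A $$ (i, l) * z $ l:]"
      by (induction n) auto
    also have "(\<Sum>l<n. if i = l then [:0, 1:] * [:z $ l:] else 0) - [:\<Sum>l<n. A $$ (i, l) * z $ l:] = [:0, 1:] * [:z $ i:] - [:\<Sum>l<n. A $$ (i, l) * z $ l:]"
      using i by simp
    also have "\<dots> = p * [:z $ i:]" unfolding e p_def by (simp add: algebra_simps)
    finally show ?thesis .
  qed
  define N1 where "N1 = Matrix.mat n n (\<lambda>(i, l). if l = j then [:v $ i:] else N $$ (i, l))"
  define N2 where "N2 = Matrix.mat n n (\<lambda>(i, l). if l = k then [:w $ i:] else N1 $$ (i, l))"
  have N12: "N1 \<in> carrier_mat n n" "N2 \<in> carrier_mat n n" by (auto simp: N1_def N2_def)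
  \<comment> \<open>A factor common to one column comes out of the determinant.\<close>
  have sc: "Determinant.det (replace_col B (vec n (\<lambda>i. p * q i)) l) = p * Determinant.det (replace_col B (vec n q) l)"
    if "B \<in> carrier_mat n n" "l < n" for B q l
  proof -
    have r: "replace_col B (vec n q) l \<in> carrier_mat n n" using that by (auto simp: replace_col_def)
    have "replace_col B (vec n (\<lambda>i. p * q i)) l = multcol l p (replace_col B (vec n q) l)"
      using that by (intro eq_matI) (auto simp: replace_col_def mat_multcol_def)
    thus ?thesis using that(2) det_mult[OF r, of "multrow_mat n l p"] multcol_mat[OF r, of l p]
      by (simp add: det_multrow_mat)
  qed
  have "N *\<^sub>v V = vec n (\<lambda>i. p * [:v $ i:])"
    using eig[OF v Av] N by (intro eq_vecI) (auto simp: V_def)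
  moreover have "replace_col N (vec n (\<lambda>i. [:v $ i:])) j = N1"
    using N by (intro eq_matI) (auto simp: replace_col_def N1_def)
  ultimately have 1: "p * Determinant.det N1 = [:v $ j:] * Determinant.det N"
    using cramer_lemma_mat[OF N VW(1) jk(1)] sc[OF N jk(1), of "\<lambda>i. [:v $ i:]"] jk v by (simp add: V_def)
  \<comment> \<open>\<open>N1\<close> differs from \<open>N\<close> only in column \<open>j\<close>,
    which meets the zero entry \<open>w $ j\<close>.\<close>
  have "N1 *\<^sub>v W = N *\<^sub>v W"
  proof (rule eq_vecI)
    fix i assume i: "i < dim_vec (N *\<^sub>v W)"
    hence "i < n" using N by simp
    thus "(N1 *\<^sub>v W) $ i = (N *\<^sub>v W) $ i" using N N12 VW w nz(3)
      by (auto simp: scalar_prod_def N1_def W_def intro!: sum.cong)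
  qed (use N N12 in auto)
  also have "\<dots> = vec n (\<lambda>i. p * [:w $ i:])"
    using eig[OF w Aw] N by (intro eq_vecI) (auto simp: W_def)
  finally have "N1 *\<^sub>v W = vec n (\<lambda>i. p * [:w $ i:])" .
  moreover have "replace_col N1 (vec n (\<lambda>i. [:w $ i:])) k = N2"
    using N12 by (intro eq_matI) (auto simp: replace_col_def N2_def)
  ultimately have 2: "p * Determinant.det N2 = [:w $ k:] * Determinant.det N1"
    using cramer_lemma_mat[OF N12(1) VW(2) jk(2)] sc[OF N12(1) jk(2), of "\<lambda>i. [:w $ i:]"] jk w by (simp add: W_def)
  have "p ^ 2 * Determinant.det N2 = p * ([:w $ k:] * Determinant.det N1)"
    using 2 by (simp add: power2_eq_square mult.assoc)
  also have "\<dots> = [:w $ k:] * ([:v $ j:] * Determinant.det N)"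
    using 1 by (simp add: mult.left_commute mult.commute)
  also have "\<dots> = Polynomial.smult (w $ k * v $ j) (char_poly A)"
    by (simp add: char_poly_def N_def mult.commute)
  finally have "p ^ 2 dvd Polynomial.smult (w $ k * v $ j) (char_poly A)"
    by (metis dvd_triv_left)
  thus ?thesis using nz by (simp add: p_def dvd_smult_iff)
qed

section \<open>Scaling of the spectrum by a constant\<close>

lemma char_poly_smult:
  fixes A :: "real mat"
  assumes A: "A \<in> carrier_mat n n" and c: "c \<noteq> 0"
  shows "char_poly (c \<cdot>\<^sub>m A) = Polynomial.smult (c ^ n) (pcompose (char_poly A) [:0, 1 / c:])"
proof -
  have cA: "c \<cdot>\<^sub>m A \<in> carrier_mat n n" using A by simp
  have "poly (char_poly (c \<cdot>\<^sub>m A)) x =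
      poly (Polynomial.smult (c ^ n) (pcompose (char_poly A) [:0, 1 / c:])) x" for x
  proof -
    \<comment> \<open>Pointwise, \<open>det (x I - c A) = c ^ n * det ((x / c) I - A)\<close>; real
      polynomials with equal values everywhere are equal.\<close>
    have "- char_matrix (c \<cdot>\<^sub>m A) x = c \<cdot>\<^sub>m (- char_matrix A (x / c))"
      using A c by (intro eq_matI) (auto simp: char_matrix_def field_simps)
    moreover have "dim_col (char_matrix A (x / c)) = n" using A by (simp add: char_matrix_def)
    ultimately show ?thesis
      by (simp add: char_poly_matrix[OF A] char_poly_matrix[OF cA] poly_pcompose)
  qed
  thus ?thesis by (simp add: poly_eq_poly_eq_iff[symmetric] fun_eq_iff)
qed

text \<open>The substitution moves a root \<open>a\<close> to \<open>c * a\<close> without changing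
  its order. One divisibility statement gives both inequalities between the orders, since the
  substitution for \<open>1 / c\<close> undoes the one for \<open>c\<close>.\<close>

lemma proots_pcompose_scale:
  fixes p :: "real poly"
  assumes p: "p \<noteq> 0" and c: "c \<noteq> 0"
  shows "proots (pcompose p [:0, 1 / c:]) = image_mset ((*) c) (proots p)"
proof (rule multiset_eqI)
  fix a
  let ?q = "pcompose p [:0, 1 / c:]"
  have lin: "pcompose [:- a, 1:] [:0, 1 / d:] = Polynomial.smult (1 / d) [:- (d * a), 1:]"
    if "d \<noteq> 0" for a d :: real
    using that by (simp add: pcompose_pCons)
  have dv: "[:- (d * a), 1:] ^ k dvd pcompose r [:0, 1 / d:]"
    if r: "[:- a, 1:] ^ k dvd r" and d: "d \<noteq> 0" for a d k and r :: "real poly"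
  proof -
    have hom_pow: "pcompose (x ^ k) y = pcompose x y ^ k" for x y :: "real poly" and k
      by (induction k) (auto simp: pcompose_mult pcompose_1)
    obtain s where "r = [:- a, 1:] ^ k * s" using r by blast
    hence "pcompose r [:0, 1 / d:] = Polynomial.smult ((1 / d) ^ k) ([:- (d * a), 1:] ^ k * pcompose s [:0, 1 / d:])"
      by (simp only: pcompose_mult hom_pow lin[OF d] smult_power mult_smult_left)
    thus ?thesis by (simp add: dvd_smult)
  qed
  have inverse_scale: "pcompose ?q [:0, 1 / (1 / c):] = p"
    using c by (simp add: pcompose_assoc[symmetric] pcompose_pCons pcompose_idR)
  have q: "?q \<noteq> 0" using p inverse_scale by auto
  have ord: "order a ?q = order (a / c) p"
  proof (rule antisym)
    have "[:- (1 / c * a), 1:] ^ order a ?q dvd p"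
      using dv[OF order_1, of "1 / c" a ?q] c inverse_scale by simp
    thus "order a ?q \<le> order (a / c) p" using p by (simp add: order_divides)
    have "[:- (c * (a / c)), 1:] ^ order (a / c) p dvd ?q"
      by (rule dv[OF order_1]) fact
    thus "order (a / c) p \<le> order a ?q" using q c by (simp add: order_divides)
  qed
  have "(*) c -` {a} = {a / c}" using c by (auto simp: field_simps)
  hence "count (image_mset ((*) c) (proots p)) a = count (proots p) (a / c)"
    by (cases "a / c \<in># proots p") (auto simp: count_image_mset not_in_iff)
  with ord p q c show "count (proots ?q) a = count (image_mset ((*) c) (proots p)) a" by simp
qed

text \<open>A positive factor keeps the list sorted, and a sorted list is determined by its multiset
  of entries.\<close>

lemma eigenvalues_sorted_smult:
  fixes A :: "real mat"
  assumes A: "A \<in> carrier_mat n n" and c: "c > 0"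
  shows "eigenvalues_sorted (c \<cdot>\<^sub>m A) = map ((*) c) (eigenvalues_sorted A)"
proof -
  have "proots (char_poly (c \<cdot>\<^sub>m A)) = image_mset ((*) c) (proots (char_poly A))"
    using c proots_pcompose_scale[OF char_poly_nonzero[OF A], of c]
    by (simp add: char_poly_smult[OF A])
  moreover have "sorted_list_of_multiset (image_mset ((*) c) X) = map ((*) c) (sorted_list_of_multiset X)" for X
  proof -
    have "sorted (map ((*) c) (sorted_list_of_multiset X))"
      using c by (auto simp: sorted_map intro!: sorted_wrt_mono_rel[OF _ sorted_sorted_list_of_multiset])
    from sorted_sort_id[OF this] show ?thesis
      by (metis mset_map mset_sorted_list_of_multiset sorted_list_of_multiset_mset)
  qed
  ultimately show ?thesis by (simp add: eigenvalues_sorted_def)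
qed

text \<open>Also true when there are fewer than two eigenvalues: indexing past the end of both lists then
  yields the same unspecified value.\<close>
lemma lambda_2_smult_pos:
  assumes "A \<in> carrier_mat n n" and "c > 0" and "lambda_k 2 A > 0"
  shows "lambda_k 2 (c \<cdot>\<^sub>m A) > 0"
proof -
  obtain xs where xs: "eigenvalues_sorted A = xs" by blast
  show ?thesis using assms
    by (cases xs; cases "tl xs") (auto simp: lambda_k_def eigenvalues_sorted_smult xs)
qed

text \<open>The minimiser of the quadratic form on the unit sphere orthogonal to the constants is an
  eigenvector, and its eigenvalue together with the eigenvalue 0 of the constant vector gives two
  eigenvalues below the minimum.\<close>
lemma lambda_2_le_quadratic_form:
  fixes A :: "real mat" and x :: "nat \<Rightarrow> real"
  assumes A: "A \<in> carrier_mat n n"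
    and sym: "\<And>i j. i < n \<Longrightarrow> j < n \<Longrightarrow> A $$ (i, j) = A $$ (j, i)"
    and rows: "\<And>i. i < n \<Longrightarrow> (\<Sum>j<n. A $$ (i, j)) = 0"
    and psd: "\<And>x. 0 \<le> (\<Sum>i<n. \<Sum>j<n. A $$ (i, j) * x i * x j)"
    and x: "(\<Sum>i<n. x i) = 0"
  shows "lambda_k 2 A * (\<Sum>i<n. (x i)\<^sup>2) \<le> (\<Sum>i<n. \<Sum>j<n. A $$ (i, j) * x i * x j)"
proof -
  define Q where "Q x = (\<Sum>i<n. \<Sum>j<n. A $$ (i, j) * x i * x j)" for x :: "nat \<Rightarrow> real"
  define N where "N x = (\<Sum>i<n. (x i)\<^sup>2)" for x :: "nat \<Rightarrow> real"
  \<comment> \<open>Coordinates from \<open>n\<close> on are pinned to 0, so that the unit sphere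
    orthogonal to the constants is a closed part of a product of compact sets, compact by
    Tychonoff's theorem.\<close>
  define K where "K = (PiE UNIV (\<lambda>i. if i < n then {-1..1} else {0})) \<inter> {x. N x = 1} \<inter> {x. (\<Sum>i<n. x i) = 0}"
  have N_nonneg: "0 \<le> N z" for z by (simp add: N_def sum_nonneg)
  have N0: "z i = 0" if "N z = 0" "i < n" for z i
    using that sum_nonneg_eq_0_iff[of "{..<n}" "\<lambda>i. (z i)\<^sup>2"] by (simp add: N_def)
  have scale: "(\<lambda>i. if i < n then z i / sqrt (N z) else 0) \<in> K"
    "Q (\<lambda>i. if i < n then z i / sqrt (N z) else 0) = Q z / N z"
    if z: "(\<Sum>i<n. z i) = 0" "N z \<noteq> 0" for z
  proof -
    let ?z = "\<lambda>i. if i < n then z i / sqrt (N z) else 0"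
    have pos: "N z > 0" using N_nonneg[of z] z by simp
    have "\<bar>z i\<bar> \<le> sqrt (N z)" if "i < n" for i
    proof -
      have "(z i)\<^sup>2 \<le> N z" unfolding N_def
        by (rule member_le_sum) (use that in auto)
      thus ?thesis using real_le_rsqrt by fastforce
    qed
    hence "\<bar>z i / sqrt (N z)\<bar> \<le> 1" if "i < n" for i using pos that by (simp add: field_simps)
    hence 1: "?z \<in> PiE UNIV (\<lambda>i. if i < n then {-1..1} else {0})"
      by (auto simp: PiE_def Pi_def abs_le_iff simp del: abs_divide)
    have "N ?z = N z / N z"
      unfolding N_def[of ?z] using pos
      by (simp add: power_divide sum_divide_distrib[symmetric]) (simp add: N_def)
    moreover have "(\<Sum>i<n. ?z i) = 0" using z by (simp add: sum_divide_distrib[symmetric])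
    ultimately show "?z \<in> K" using pos 1 by (simp add: K_def)
    have "Q ?z = (\<Sum>i<n. \<Sum>j<n. A $$ (i, j) * z i * z j / (sqrt (N z) * sqrt (N z)))"
      unfolding Q_def by (intro sum.cong) auto
    thus "Q ?z = Q z / N z" using pos by (simp add: Q_def sum_divide_distrib)
  qed
  show ?thesis
  proof (cases "N x = 0")
    case True
    from N0[OF True] show ?thesis by simp
  next
    case False
    have "compact (PiE UNIV (\<lambda>i. if i < n then {-1..1::real} else {0}))"
      using compactin_PiE[of "\<lambda>_::nat. euclidean :: real topology" UNIV "\<lambda>i. if i < n then {-1..1} else {0}"]
      by (simp add: euclidean_product_topology)
    hence cK: "compact K" unfolding K_def N_def Int_assoc
      by (intro compact_Int_closed closed_Int closed_Collect_eq continuous_intros continuous_on_product_coordinates)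
    have "continuous_on K Q" unfolding Q_def
      by (intro continuous_intros continuous_on_subset[OF continuous_on_product_coordinates]) auto
    with cK scale[OF x False] obtain v where v: "v \<in> K" "\<And>y. y \<in> K \<Longrightarrow> Q v \<le> Q y"
      using continuous_attains_inf[of K Q] by blast
    define \<mu> where "\<mu> = Q v"
    have Nv: "N v = 1" and sv: "(\<Sum>i<n. v i) = 0" using v(1) by (auto simp: K_def)
    have ray: "\<mu> * N z \<le> Q z" if z: "(\<Sum>i<n. z i) = 0" for z
    proof (cases "N z = 0")
      case True
      have "Q z = 0" using N0[OF True] by (simp add: Q_def)
      thus ?thesis using True by simp
    next
      case False
      have "\<mu> \<le> Q z / N z" using v(2)[OF scale(1)[OF z False]] scale(2)[OF z False] by (simp add: \<mu>_def)
      thus ?thesis using N_nonneg[of z] False by (simp add: field_simps)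
    qed
    \<comment> \<open>The residual of the eigenvalue equation at the minimiser, to be shown zero.
      Symmetry turns vanishing row sums into vanishing column sums, so \<open>r\<close> is
      orthogonal to the constants and an admissible direction.\<close>
    define r where "r i = (\<Sum>j<n. A $$ (i, j) * v j) - \<mu> * v i" for i
    have "(\<Sum>i<n. \<Sum>j<n. A $$ (i, j) * v j) = (\<Sum>j<n. \<Sum>i<n. A $$ (j, i) * v j)"
      by (subst sum.swap) (auto intro!: sum.cong simp: sym)
    also have "\<dots> = 0" by (simp add: sum_distrib_right[symmetric] rows)
    finally have sr: "(\<Sum>i<n. r i) = 0" by (simp add: r_def sum_subtractf sum_distrib_left[symmetric] sv)
    define C where "C = Q r - \<mu> * N r"
    have C: "0 \<le> C" using ray[OF sr] by (simp add: C_def)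
    \<comment> \<open>Perturbing the minimiser along its own residual gives the first-order term
      \<open>2 * e * N r\<close>, which minimality forces to vanish.\<close>
    have expand: "Q (\<lambda>i. v i + e * r i) - \<mu> * N (\<lambda>i. v i + e * r i) = 2 * e * N r + e\<^sup>2 * C" for e
    proof -
      have s1: "(\<Sum>i<n. \<Sum>j<n. A $$ (i, j) * r i * v j) = (\<Sum>i<n. r i * (\<Sum>j<n. A $$ (i, j) * v j))"
        by (simp add: sum_distrib_left mult_ac)
      have "(\<Sum>i<n. \<Sum>j<n. A $$ (i, j) * v i * r j) = (\<Sum>j<n. \<Sum>i<n. A $$ (j, i) * r j * v i)"
        by (subst sum.swap) (auto intro!: sum.cong simp: sym)
      hence s2: "(\<Sum>i<n. \<Sum>j<n. A $$ (i, j) * v i * r j) = (\<Sum>i<n. \<Sum>j<n. A $$ (i, j) * r i * v j)" by simp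
      have "Q (\<lambda>i. v i + e * r i) = Q v + e * (\<Sum>i<n. \<Sum>j<n. A $$ (i, j) * v i * r j)
          + e * (\<Sum>i<n. \<Sum>j<n. A $$ (i, j) * r i * v j) + e\<^sup>2 * Q r"
        by (simp add: Q_def sum_distrib_left sum.distrib[symmetric] algebra_simps power2_eq_square)
      also have "\<dots> = Q v + 2 * e * (\<Sum>i<n. r i * (\<Sum>j<n. A $$ (i, j) * v j)) + e\<^sup>2 * Q r"
        unfolding s2 s1 by simp
      finally have q: "Q (\<lambda>i. v i + e * r i) = Q v + 2 * e * (\<Sum>i<n. r i * (\<Sum>j<n. A $$ (i, j) * v j)) + e\<^sup>2 * Q r" .
      have nn: "N (\<lambda>i. v i + e * r i) = N v + 2 * e * (\<Sum>i<n. r i * v i) + e\<^sup>2 * N r"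
        by (simp add: N_def sum_distrib_left sum.distrib[symmetric] algebra_simps power2_eq_square)
      have "(\<Sum>i<n. r i * (\<Sum>j<n. A $$ (i, j) * v j)) - \<mu> * (\<Sum>i<n. r i * v i) = (\<Sum>i<n. r i * r i)"
        by (subst (3) r_def) (simp add: sum_distrib_left sum_subtractf[symmetric] algebra_simps)
      hence "(\<Sum>i<n. r i * (\<Sum>j<n. A $$ (i, j) * v j)) = N r + \<mu> * (\<Sum>i<n. r i * v i)"
        by (simp add: N_def power2_eq_square)
      thus ?thesis unfolding q nn C_def using Nv by (simp add: \<mu>_def algebra_simps)
    qed
    have "N r = 0"
    proof -
      \<comment> \<open>With this step size the expansion equals
        \<open>- (N r)\<^sup>2 * (C + 2) / (C + 1)\<^sup>2\<close>; the denominator is positive as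
        \<open>C\<close> is nonnegative.\<close>
      define e where "e = - N r / (C + 1)"
      have "(\<Sum>i<n. v i + e * r i) = 0" using sv sr by (simp add: sum.distrib sum_distrib_left[symmetric])
      from ray[OF this] expand[of e] have "0 \<le> 2 * e * N r + e\<^sup>2 * C" by simp
      hence "0 \<le> (2 * e * N r + e\<^sup>2 * C) * (C + 1)\<^sup>2" by simp
      also have "\<dots> = 2 * (e * (C + 1)) * N r * (C + 1) + (e * (C + 1))\<^sup>2 * C"
        by (simp add: power2_eq_square algebra_simps)
      also have "e * (C + 1) = - N r" using C by (simp add: e_def)
      also have "2 * (- N r) * N r * (C + 1) + (- N r)\<^sup>2 * C = - (N r)\<^sup>2 * (C + 2)"
        by (simp add: power2_eq_square algebra_simps)
      finally have "(N r)\<^sup>2 * (C + 2) \<le> 0" by simp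
      with C show ?thesis by (smt (verit) mult_pos_pos zero_less_power2)
    qed
    hence r0: "(\<Sum>j<n. A $$ (i, j) * v j) = \<mu> * v i" if "i < n" for i
      using N0[of r i] that by (simp add: r_def)
    have ev: "A *\<^sub>v vec n v = \<mu> \<cdot>\<^sub>v vec n v" 
      using A r0 by (intro eq_vecI) (auto simp: scalar_prod_def lessThan_atLeast0)
    have e1: "A *\<^sub>v vec n (\<lambda>_. 1) = 0 \<cdot>\<^sub>v vec n (\<lambda>_. 1)" 
      using A rows by (intro eq_vecI) (auto simp: scalar_prod_def lessThan_atLeast0)
    obtain l where l: "l < n" "v l \<noteq> 0" using Nv by (force simp: N_def intro: ccontr)
    have "lambda_k 2 A \<le> \<mu>"
    proof (cases "\<mu> = 0")
      case False
      have "eigenvalue A \<mu>"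
        unfolding eigenvalue_def eigenvector_def using A ev l
        by (intro exI[of _ "vec n v"]) (auto dest!: arg_cong[of _ _ "\<lambda>z. z $ l"])
      moreover have "eigenvalue A 0"
        unfolding eigenvalue_def eigenvector_def using A e1 l
        by (intro exI[of _ "vec n (\<lambda>_. 1)"]) (auto dest!: arg_cong[of _ _ "\<lambda>z. z $ l"])
      moreover have "0 \<le> \<mu>" using psd[of v] by (simp add: \<mu>_def Q_def)
      ultimately show ?thesis using False by (intro lambda_2_le_of_two_eigenvalues[OF A, of \<mu> 0]) auto
    next
      \<comment> \<open>Here 0 must be a double root. Since \<open>v\<close> has sum 0 and
        \<open>v l\<close> is nonzero, \<open>v\<close> is not constant; subtracting
        \<open>v l\<close> gives a second null vector that vanishes at \<open>l\<close>, where the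
        constant vector does not.\<close>
      case True
      obtain k where k: "k < n" "v k \<noteq> v l"
      proof (rule ccontr)
        assume "\<not> thesis"
        hence "(\<Sum>i<n. v i) = (\<Sum>i<n. v l)" using that by (intro sum.cong) auto
        thus False using sv l by simp
      qed
      have ew: "A *\<^sub>v vec n (\<lambda>i. v i - v l) = 0 \<cdot>\<^sub>v vec n (\<lambda>i. v i - v l)"
        using A rows r0 True by (intro eq_vecI)
          (auto simp: scalar_prod_def lessThan_atLeast0 algebra_simps sum_subtractf sum_distrib_left[symmetric])
      show ?thesis unfolding True
        by (rule lambda_2_le_of_double_root[OF A], rule double_root_of_two_eigenvectors[OF A _ _ e1 ew, of l k])
          (use l k in auto)
    qed
    hence "lambda_k 2 A * N x \<le> \<mu> * N x" using N_nonneg by (rule mult_right_mono)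
    also have "\<dots> \<le> Q x" by (rule ray[OF x])
    finally show ?thesis by (simp add: N_def Q_def)
  qed
qed

subsection \<open>Concentration of sums of random multiples of fixed vectors\<close>

text \<open>Hoeffding's lemma for an interval of length \<open>2 * B\<close>, whence the exponent
  \<open>l\<^sup>2 * (2 * B)\<^sup>2 / 8\<close>. Negative \<open>l\<close> reduces to positive
  \<open>l\<close> by passing to \<open>- X\<close>.\<close>

lemma nn_integral_exp_le_of_bounded:
  fixes p :: "'a pmf" and X :: "'a \<Rightarrow> real"
  assumes bd: "\<And>y. y \<in> set_pmf p \<Longrightarrow> \<bar>X y\<bar> \<le> B"
    and mean: "measure_pmf.expectation p X = 0"
  shows "(\<integral>\<^sup>+ y. exp (l * X y) \<partial>p) \<le> ennreal (exp (l\<^sup>2 * B\<^sup>2 / 2))"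
proof -
  have pos: "(\<integral>\<^sup>+ y. exp (l * X y) \<partial>p) \<le> ennreal (exp (l\<^sup>2 * B\<^sup>2 / 2))"
    if l: "l > 0" and bd: "\<And>y. y \<in> set_pmf p \<Longrightarrow> \<bar>X y\<bar> \<le> B"
      and mean: "measure_pmf.expectation p X = 0" for l and X :: "'a \<Rightarrow> real"
  proof -
    interpret interval_bounded_random_variable "measure_pmf p" X "-B" B
      by unfold_locales (use bd in \<open>force simp: AE_measure_pmf_iff\<close>)+
    show ?thesis
      using Hoeffdings_lemma_nn_integral_0[OF l mean] by (simp add: power2_eq_square mult_ac)
  qed
  consider "l > 0" | "l = 0" | "l < 0" by linarith
  thus ?thesis
  proof cases
    case 1 thus ?thesis using pos[OF 1 bd mean] by simp
  next
    case 2 thus ?thesis by simp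
  next
    case 3 thus ?thesis using pos[of "- l" "\<lambda>y. - X y"] bd mean by simp
  qed
qed

text \<open>Expand the square: the term quadratic in \<open>\<xi> y\<close> is at most
  \<open>B\<^sup>2 * c\<close>, Hoeffding's lemma with \<open>l = 2 * a * s\<close> handles the
  linear one, and Cauchy-Schwarz in the form \<open>s\<^sup>2 \<le> N * c\<close> makes its cost
  proportional to the squared norm of \<open>x\<close>.\<close>

lemma nn_integral_exp_sq_norm_add_le:
  fixes p :: "'a pmf" and \<xi> :: "'a \<Rightarrow> real" and x u :: "nat \<Rightarrow> real"
  assumes bd: "\<And>y. y \<in> set_pmf p \<Longrightarrow> \<bar>\<xi> y\<bar> \<le> B"
    and mean: "measure_pmf.expectation p \<xi> = 0"
    and u: "(\<Sum>k<n. (u k)\<^sup>2) \<le> c" and a: "a > 0"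
  shows "(\<integral>\<^sup>+ y. exp (a * (\<Sum>k<n. (x k + \<xi> y * u k)\<^sup>2)) \<partial>p)
    \<le> ennreal (exp ((a + 2 * a\<^sup>2 * B\<^sup>2 * c) * (\<Sum>k<n. (x k)\<^sup>2) + a * B\<^sup>2 * c))"
proof -
  define N where "N = (\<Sum>k<n. (x k)\<^sup>2)"
  define U where "U = (\<Sum>k<n. (u k)\<^sup>2)"
  define s where "s = (\<Sum>k<n. x k * u k)"
  have UN: "0 \<le> U" "0 \<le> N" by (simp_all add: U_def N_def sum_nonneg)
  have "s\<^sup>2 \<le> N * U"
    unfolding s_def N_def U_def by (rule Cauchy_Schwarz_ineq_sum)
  also have "\<dots> \<le> N * c" using u UN by (intro mult_left_mono) (auto simp: U_def)
  finally have s: "s\<^sup>2 \<le> N * c" .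
  have pt: "exp (a * (\<Sum>k<n. (x k + \<xi> y * u k)\<^sup>2)) \<le> exp (a * N + a * B\<^sup>2 * c) * exp ((2 * a * s) * \<xi> y)"
    if "y \<in> set_pmf p" for y
  proof -
    have "(\<Sum>k<n. (x k + \<xi> y * u k)\<^sup>2) = N + 2 * \<xi> y * s + (\<xi> y)\<^sup>2 * U"
      by (simp add: N_def s_def U_def sum_distrib_left sum.distrib[symmetric] algebra_simps power2_eq_square)
    moreover have "(\<xi> y)\<^sup>2 * U \<le> B\<^sup>2 * c"
      using bd[OF that] u UN by (intro mult_mono) (auto simp: U_def abs_le_square_iff[symmetric])
    ultimately have "(\<Sum>k<n. (x k + \<xi> y * u k)\<^sup>2) \<le> N + 2 * \<xi> y * s + B\<^sup>2 * c" by simp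
    hence "a * (\<Sum>k<n. (x k + \<xi> y * u k)\<^sup>2) \<le> a * (N + 2 * \<xi> y * s + B\<^sup>2 * c)"
      using a by (intro mult_left_mono) auto
    thus ?thesis by (simp add: exp_add[symmetric] algebra_simps)
  qed
  have "(\<integral>\<^sup>+ y. exp (a * (\<Sum>k<n. (x k + \<xi> y * u k)\<^sup>2)) \<partial>p)
      \<le> (\<integral>\<^sup>+ y. ennreal (exp (a * N + a * B\<^sup>2 * c)) * ennreal (exp ((2 * a * s) * \<xi> y)) \<partial>p)"
    by (intro nn_integral_mono_AE)
      (use pt in \<open>auto simp: AE_measure_pmf_iff ennreal_mult[symmetric] intro!: ennreal_leI\<close>)
  also have "\<dots> = ennreal (exp (a * N + a * B\<^sup>2 * c)) * (\<integral>\<^sup>+ y. exp ((2 * a * s) * \<xi> y) \<partial>p)"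
    by (rule nn_integral_cmult) auto
  also have "\<dots> \<le> ennreal (exp (a * N + a * B\<^sup>2 * c)) * ennreal (exp ((2 * a * s)\<^sup>2 * B\<^sup>2 / 2))"
    by (intro mult_left_mono nn_integral_exp_le_of_bounded bd mean) auto
  also have "\<dots> = ennreal (exp (a * N + a * B\<^sup>2 * c + (2 * a * s)\<^sup>2 * B\<^sup>2 / 2))"
    by (simp add: ennreal_mult[symmetric] exp_add)
  also have "\<dots> \<le> ennreal (exp ((a + 2 * a\<^sup>2 * B\<^sup>2 * c) * N + a * B\<^sup>2 * c))"
  proof -
    have "2 * a\<^sup>2 * B\<^sup>2 * s\<^sup>2 \<le> 2 * a\<^sup>2 * B\<^sup>2 * (N * c)"
      using s by (intro mult_left_mono) auto
    thus ?thesis by (intro ennreal_leI) (simp add: algebra_simps)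
  qed
  finally show ?thesis by (simp add: N_def)
qed

text \<open>The exponents \<open>a\<^sub>t = 1 / (2 c B\<^sup>2 (K + t))\<close> satisfy \<open>a\<^sub>t + 2 a\<^sub>t\<^sup>2 B\<^sup>2 c \<le> a\<^sub>t\<^sub>-\<^sub>1\<close>, which absorbs
  the growth produced by one summand.\<close>
lemma nn_integral_exp_sq_norm_sum_le:
  fixes p :: "nat \<Rightarrow> 'a pmf" and \<xi> :: "nat \<Rightarrow> 'a \<Rightarrow> real" and u :: "nat \<Rightarrow> nat \<Rightarrow> real"
  assumes bd: "\<And>t y. t < m \<Longrightarrow> y \<in> set_pmf (p t) \<Longrightarrow> \<bar>\<xi> t y\<bar> \<le> B"
    and mean: "\<And>t. t < m \<Longrightarrow> measure_pmf.expectation (p t) (\<xi> t) = 0"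
    and u: "\<And>t. t < m \<Longrightarrow> (\<Sum>k<n. (u t k)\<^sup>2) \<le> c"
    and B: "B > 0" and c: "c > 0" and K: "K > 0"
  shows "(\<integral>\<^sup>+ y. exp ((\<Sum>k<n. (\<Sum>t<m. \<xi> t (y t) * u t k)\<^sup>2) / (2 * c * B\<^sup>2 * (K + real m))) \<partial>Pi_pmf {..<m} d p)
    \<le> ennreal (exp (\<Sum>t<m. 1 / (2 * (K + real (Suc t)))))"
  using bd mean u
proof (induction m)
  case 0
  show ?case by simp
next
  case (Suc m)
  define D where "D = 2 * c * B\<^sup>2"
  have D: "D > 0" using B c by (simp add: D_def)
  define a where "a = 1 / (D * (K + real (Suc m)))"
  have a: "a > 0" using D K by (simp add: a_def)
  define X where "X y k = (\<Sum>t<m. \<xi> t (y t) * u t k)" for y k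
  have a_step: "a + 2 * a\<^sup>2 * B\<^sup>2 * c \<le> 1 / (D * (K + real m))"
  proof -
    define q where "q = K + real m"
    have q: "q > 0" using K by (simp add: q_def)
    have "a + 2 * a\<^sup>2 * B\<^sup>2 * c = a + a\<^sup>2 * D" by (simp add: D_def)
    also have "\<dots> = (1 / D) * ((q + 2) / (q + 1)\<^sup>2)"
      using D q unfolding a_def q_def[symmetric]
      by (simp add: q_def[symmetric] add.assoc[symmetric] power2_eq_square divide_simps) (simp add: q_def algebra_simps)
    \<comment> \<open>This is \<open>q * (q + 2) \<le> (q + 1)\<^sup>2\<close>.\<close>
    also have "(q + 2) / (q + 1)\<^sup>2 \<le> 1 / q"
      using q by (simp add: power2_eq_square divide_simps) (simp add: algebra_simps)
    finally show ?thesis using D by (simp add: q_def divide_right_mono)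
  qed
  \<comment> \<open>The additive cost of the new summand is exactly the new term of the sum in the
    exponent.\<close>
  have a_B: "a * B\<^sup>2 * c = 1 / (2 * (K + real (Suc m)))"
    using B c K by (simp add: a_def D_def divide_simps)
  \<comment> \<open>By independence the last coordinate may be integrated first, with the other
    summands frozen in \<open>X y\<close>.\<close>
  have "(\<integral>\<^sup>+ y. exp ((\<Sum>k<n. (\<Sum>t<Suc m. \<xi> t (y t) * u t k)\<^sup>2) / (2 * c * B\<^sup>2 * (K + real (Suc m)))) \<partial>Pi_pmf {..<Suc m} d p)
     = (\<integral>\<^sup>+ y. \<integral>\<^sup>+ z. exp (a * (\<Sum>k<n. (X y k + \<xi> m z * u m k)\<^sup>2)) \<partial>p m \<partial>Pi_pmf {..<m} d p)"
    unfolding lessThan_Suc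
    by (subst Pi_pmf_insert, simp, simp, subst pair_commute_pmf)
       (simp add: nn_integral_pair_pmf' X_def a_def D_def add.commute cong: sum.cong_simp)
  also have "\<dots> \<le> (\<integral>\<^sup>+ y. ennreal (exp ((\<Sum>k<n. (X y k)\<^sup>2) / (D * (K + real m)))) * ennreal (exp (1 / (2 * (K + real (Suc m))))) \<partial>Pi_pmf {..<m} d p)"
  proof (intro nn_integral_mono)
    fix y
    have "(\<integral>\<^sup>+ z. exp (a * (\<Sum>k<n. (X y k + \<xi> m z * u m k)\<^sup>2)) \<partial>p m)
      \<le> ennreal (exp ((a + 2 * a\<^sup>2 * B\<^sup>2 * c) * (\<Sum>k<n. (X y k)\<^sup>2) + a * B\<^sup>2 * c))"
      by (intro nn_integral_exp_sq_norm_add_le a Suc.prems) auto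
    also have "\<dots> \<le> ennreal (exp (1 / (D * (K + real m)) * (\<Sum>k<n. (X y k)\<^sup>2) + 1 / (2 * (K + real (Suc m)))))"
      unfolding a_B using mult_right_mono[OF a_step, of "\<Sum>k<n. (X y k)\<^sup>2"]
      by (intro ennreal_leI) (simp add: sum_nonneg)
    finally show "(\<integral>\<^sup>+ z. exp (a * (\<Sum>k<n. (X y k + \<xi> m z * u m k)\<^sup>2)) \<partial>p m) \<le>
       ennreal (exp ((\<Sum>k<n. (X y k)\<^sup>2) / (D * (K + real m)))) * ennreal (exp (1 / (2 * (K + real (Suc m)))))"
      by (simp add: ennreal_mult[symmetric] exp_add)
  qed
  also have "\<dots> = (\<integral>\<^sup>+ y. exp ((\<Sum>k<n. (X y k)\<^sup>2) / (D * (K + real m))) \<partial>Pi_pmf {..<m} d p) * ennreal (exp (1 / (2 * (K + real (Suc m)))))"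
    by (rule nn_integral_multc) auto
  also have "\<dots> \<le> ennreal (exp (\<Sum>t<m. 1 / (2 * (K + real (Suc t))))) * ennreal (exp (1 / (2 * (K + real (Suc m)))))"
    unfolding X_def D_def by (intro mult_right_mono Suc.IH Suc.prems) auto
  also have "\<dots> = ennreal (exp (\<Sum>t<Suc m. 1 / (2 * (K + real (Suc t)))))"
    by (simp add: ennreal_mult[symmetric] exp_add)
  finally show ?case .
qed

text \<open>Take \<open>K = m\<close> in the moment bound: the normalisation becomes
  \<open>4 * c * B\<^sup>2 * m\<close>, and the exponent is a sum of \<open>m\<close> terms of size
  at most \<open>1 / (2 * m)\<close>. Markov's inequality for the exponential finishes.\<close>

lemma sq_norm_sum_tail_bound:
  fixes p :: "nat \<Rightarrow> 'a pmf" and \<xi> :: "nat \<Rightarrow> 'a \<Rightarrow> real" and u :: "nat \<Rightarrow> nat \<Rightarrow> real"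
  assumes bd: "\<And>t y. t < m \<Longrightarrow> y \<in> set_pmf (p t) \<Longrightarrow> \<bar>\<xi> t y\<bar> \<le> B"
    and mean: "\<And>t. t < m \<Longrightarrow> measure_pmf.expectation (p t) (\<xi> t) = 0"
    and u: "\<And>t. t < m \<Longrightarrow> (\<Sum>k<n. (u t k)\<^sup>2) \<le> c"
    and B: "B > 0" and c: "c > 0" and m: "m > 0"
  shows "measure_pmf.prob (Pi_pmf {..<m} d p)
      {y. (\<Sum>k<n. (\<Sum>t<m. \<xi> t (y t) * u t k)\<^sup>2) > 4 * c * B\<^sup>2 * real m * s} \<le> exp (1 / 2 - s)"
proof -
  let ?P = "Pi_pmf {..<m} d p"
  define X where "X y = (\<Sum>k<n. (\<Sum>t<m. \<xi> t (y t) * u t k)\<^sup>2)" for y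
  define R where "R = 4 * c * B\<^sup>2 * real m"
  have R: "R > 0" using B c m by (simp add: R_def)
  have "(\<Sum>t<m. 1 / (2 * (real m + real (Suc t)))) \<le> (\<Sum>t<m. 1 / (2 * real m))"
    using m by (intro sum_mono frac_le) auto
  also have "\<dots> = 1 / 2" using m by simp
  finally have h: "(\<Sum>t<m. 1 / (2 * (real m + real (Suc t)))) \<le> 1 / 2" .
  have "(\<integral>\<^sup>+ y. exp (X y / R) \<partial>?P) \<le> ennreal (exp (\<Sum>t<m. 1 / (2 * (real m + real (Suc t)))))"
  proof -
    have "R = 2 * c * B\<^sup>2 * (real m + real m)" by (simp add: R_def)
    thus ?thesis unfolding X_def using m
      by (simp only:) (intro nn_integral_exp_sq_norm_sum_le bd mean u B c, auto)
  qed
  also have "\<dots> \<le> ennreal (exp (1 / 2))" using h by (intro ennreal_leI) simp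
  finally have E: "(\<integral>\<^sup>+ y. exp (X y / R) \<partial>?P) \<le> ennreal (exp (1 / 2))" .
  have "emeasure ?P {y. X y > R * s} \<le> emeasure ?P {y \<in> space ?P. 1 \<le> ennreal (exp (- s)) * ennreal (exp (X y / R))}"
  proof (rule emeasure_mono)
    show "{y. X y > R * s} \<subseteq> {y \<in> space ?P. 1 \<le> ennreal (exp (- s)) * ennreal (exp (X y / R))}"
    proof safe
      fix y assume "X y > R * s"
      hence "0 \<le> X y / R - s" using R by (simp add: field_simps)
      thus "1 \<le> ennreal (exp (- s)) * ennreal (exp (X y / R))"
        by (simp add: ennreal_mult[symmetric] exp_add[symmetric])
    qed simp
  qed simp
  also have "\<dots> \<le> ennreal (exp (- s)) * (\<integral>\<^sup>+ y. exp (X y / R) * indicator UNIV y \<partial>?P)"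
    using nn_integral_Markov_inequality[of "\<lambda>y. ennreal (exp (X y / R))" UNIV ?P "ennreal (exp (- s))"] by simp
  also have "\<dots> \<le> ennreal (exp (- s)) * ennreal (exp (1 / 2))"
    using E by (intro mult_left_mono) auto
  also have "\<dots> = ennreal (exp (1 / 2 - s))"
    by (simp add: ennreal_mult[symmetric] exp_add[symmetric])
  finally have "emeasure ?P {y. X y > R * s} \<le> ennreal (exp (1 / 2 - s))" .
  thus ?thesis by (simp add: measure_pmf.emeasure_eq_measure X_def R_def)
qed

subsection \<open>Pairwise choice probabilities\<close>

context
  fixes F f :: "real \<Rightarrow> real"
  assumes noise: "thurstone_noise F f"
begin

text \<open>The law of one noise variable; \<open>F\<close> is its distribution function, and
  \<open>p2\<close> compares two independent copies.\<close>

definition noise_measure :: "real measure" where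
  "noise_measure = density lborel (\<lambda>x. ennreal (f x))"

lemma prob_space_noise: "prob_space noise_measure"
proof
  have "emeasure noise_measure (space noise_measure) = (\<integral>\<^sup>+ x. ennreal (f x) \<partial>lborel)"
    using noise by (simp add: noise_measure_def emeasure_density thurstone_noise_def)
  also have "\<dots> = 1" using noise
    by (subst nn_integral_eq_integral) (auto simp: thurstone_noise_def)
  finally show "emeasure noise_measure (space noise_measure) = 1" .
qed

lemma sets_noise [measurable_cong, simp]: "sets noise_measure = sets borel"
  by (simp add: noise_measure_def)

lemma space_noise [simp]: "space noise_measure = UNIV"
  by (simp add: noise_measure_def)

lemma integral_noise:
  fixes h :: "real \<Rightarrow> real"
  assumes "h \<in> borel_measurable borel"
  shows "integral\<^sup>L noise_measure h = (\<integral>z. h z * f z \<partial>lborel)"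
  using noise assms
  by (simp add: noise_measure_def integral_density thurstone_noise_def mult.commute)

lemma F_eq_noise_measure: "F x = measure noise_measure {..x}"
proof -
  interpret prob_space noise_measure by (rule prob_space_noise)
  have "measure noise_measure {..x} = integral\<^sup>L noise_measure (indicator {..x})"
    by simp
  also have "\<dots> = F x" using noise by (subst integral_noise) (auto simp: thurstone_noise_def)
  finally show ?thesis by simp
qed

lemma F_measurable: "F \<in> borel_measurable borel"
proof (rule borel_measurable_mono, rule monoI)
  interpret prob_space noise_measure by (rule prob_space_noise)
  show "F x \<le> F y" if "x \<le> y" for x y
    unfolding F_eq_noise_measure using that by (intro finite_measure_mono) auto
qed

text \<open>A law with a density has no atoms. This makes ties between two independent copies
  negligible.\<close>

lemma emeasure_noise_singleton: "emeasure noise_measure {x} = 0"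
proof -
  have "emeasure noise_measure {x} = (\<integral>\<^sup>+ z. ennreal (f z) * indicator {x} z \<partial>lborel)"
    unfolding noise_measure_def using noise by (subst emeasure_density) (auto simp: thurstone_noise_def)
  also have "\<dots> = (\<integral>\<^sup>+ z. 0 \<partial>(lborel :: real measure))"
  proof (rule nn_integral_cong_AE)
    have "AE z in lborel. z \<noteq> x" by (rule AE_lborel_singleton)
    thus "AE z in lborel. ennreal (f z) * indicator {x} z = 0" by eventually_elim simp
  qed
  finally show ?thesis by simp
qed

lemma emeasure_noise_lessThan: "emeasure noise_measure {..<x} = emeasure noise_measure {..x}"
proof -
  have "emeasure noise_measure ({..<x} \<union> {x}) = emeasure noise_measure {..<x}"
    by (rule emeasure_Un_null_set) (auto simp: null_sets_def emeasure_noise_singleton)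
  moreover have "{..<x} \<union> {x} = {..x}" by auto
  ultimately show ?thesis by simp
qed

text \<open>\<open>p2 F f x\<close> as the probability of \<open>W \<le> x + Z\<close> for
  independent copies \<open>Z\<close> and \<open>W\<close>, in the form produced by sections of the
  product measure.\<close>

lemma p2_eq_nn_integral: "ennreal (p2 F f x) = (\<integral>\<^sup>+ z. emeasure noise_measure {..x + z} \<partial>noise_measure)"
proof -
  interpret prob_space noise_measure by (rule prob_space_noise)
  note [measurable] = F_measurable
  have "p2 F f x = (\<integral>z. F (x + z) \<partial>noise_measure)"
    unfolding p2_def by (subst integral_noise) auto
  moreover have "ennreal (\<integral>z. F (x + z) \<partial>noise_measure) = (\<integral>\<^sup>+ z. F (x + z) \<partial>noise_measure)"
  proof (intro nn_integral_eq_integral[symmetric] integrable_const_bound[of _ 1])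
    show "AE z in noise_measure. norm (F (x + z)) \<le> 1" "AE z in noise_measure. 0 \<le> F (x + z)"
      by (auto simp: F_eq_noise_measure)
  qed measurable
  ultimately show ?thesis by (simp add: F_eq_noise_measure emeasure_eq_measure)
qed

lemma p2_nonneg: "0 \<le> p2 F f x"
  unfolding p2_def
  using noise by (intro Bochner_Integration.integral_nonneg) (auto simp: F_eq_noise_measure thurstone_noise_def)

text \<open>For independent copies \<open>Z\<close> and \<open>W\<close>, the events
  \<open>W \<le> x + Z\<close> and \<open>x + Z < W\<close> are complementary. The second reads
  \<open>Z < - x + W\<close> and has probability \<open>p2 F f (- x)\<close>, ties being
  null.\<close>

lemma p2_add_p2_minus: "p2 F f x + p2 F f (- x) = 1"
proof -
  interpret prob_space noise_measure by (rule prob_space_noise)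
  interpret pair_prob_space noise_measure noise_measure ..
  let ?P = "noise_measure \<Otimes>\<^sub>M noise_measure"
  define C where "C = {q :: real \<times> real. snd q \<le> x + fst q}"
  define D where "D = {q :: real \<times> real. x + fst q < snd q}"
  have sets: "C \<in> sets ?P" "D \<in> sets ?P"
  proof -
    have "{q \<in> space ?P. snd q \<le> x + fst q} \<in> sets ?P" by measurable
    thus "C \<in> sets ?P" by (simp add: C_def space_pair_measure)
    have "{q \<in> space ?P. x + fst q < snd q} \<in> sets ?P" by measurable
    thus "D \<in> sets ?P" by (simp add: D_def space_pair_measure)
  qed
  have "emeasure ?P C = (\<integral>\<^sup>+ z. emeasure noise_measure (Pair z -` C) \<partial>noise_measure)"
    by (rule sigma_finite_measure.emeasure_pair_measure_alt[OF prob_space_imp_sigma_finite[OF prob_space_noise] sets(1)])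
  also have "\<dots> = ennreal (p2 F f x)"
    unfolding p2_eq_nn_integral
    by (intro nn_integral_cong arg_cong[where f = "emeasure noise_measure"]) (auto simp: C_def)
  finally have c: "emeasure ?P C = ennreal (p2 F f x)" .
  have "emeasure ?P D = (\<integral>\<^sup>+ w. emeasure noise_measure ((\<lambda>z. (z, w)) -` D) \<partial>noise_measure)"
    by (rule emeasure_pair_measure_alt2[OF sets(2)])
  also have "\<dots> = (\<integral>\<^sup>+ w. emeasure noise_measure {..< - x + w} \<partial>noise_measure)"
    by (intro nn_integral_cong arg_cong[where f = "emeasure noise_measure"]) (auto simp: D_def)
  finally have d: "emeasure ?P D = ennreal (p2 F f (- x))"
    by (simp add: p2_eq_nn_integral emeasure_noise_lessThan)
  have "emeasure ?P C + emeasure ?P D = emeasure ?P (C \<union> D)"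
    by (rule plus_emeasure) (use sets in \<open>auto simp: C_def D_def\<close>)
  also have "C \<union> D = space ?P" by (auto simp: C_def D_def space_pair_measure)
  also have "emeasure ?P (space ?P) = 1" by (rule P.emeasure_space_1)
  finally have "ennreal (p2 F f x + p2 F f (- x)) = ennreal 1"
    using c d p2_nonneg by (simp add: ennreal_plus)
  thus ?thesis using p2_nonneg[of x] p2_nonneg[of "- x"] by (subst (asm) ennreal_inj) auto
qed

lemma p_choice_pair:
  assumes "i \<noteq> j"
  shows "p_choice F f \<theta> i {i, j} = p2 F f (\<theta> i - \<theta> j)"
proof -
  have "{i, j} - {i} = {j}" using assms by auto
  thus ?thesis by (simp add: p_choice_def p2_def)
qed

text \<open>\<open>embed_pmf\<close> returns the given weights once they are nonnegative with total
  mass 1; for a pair the total mass is \<open>p2_add_p2_minus\<close>.\<close>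

lemma pmf_choice_pair:
  assumes "i \<noteq> j"
  shows "pmf (choice_pmf F f \<theta> {i, j}) y =
    (if y = i then p2 F f (\<theta> i - \<theta> j) else if y = j then p2 F f (\<theta> j - \<theta> i) else 0)"
proof -
  let ?h = "\<lambda>y. if y \<in> {i, j} then p_choice F f \<theta> y {i, j} else 0"
  have pj: "p_choice F f \<theta> j {i, j} = p2 F f (\<theta> j - \<theta> i)"
    using p_choice_pair[of j i \<theta>] assms by (simp add: insert_commute)
  have nn: "0 \<le> ?h y" for y
    using p_choice_pair[OF assms, of \<theta>] pj p2_nonneg by auto
  have "(\<integral>\<^sup>+ y. ennreal (?h y) \<partial>count_space UNIV) = (\<Sum>y\<in>{i, j}. ennreal (?h y))"
    by (rule nn_integral_count_space') auto
  also have "\<dots> = ennreal (p2 F f (\<theta> i - \<theta> j) + p2 F f (- (\<theta> i - \<theta> j)))"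
    using assms pj p2_nonneg by (simp add: p_choice_pair ennreal_plus)
  finally have "(\<integral>\<^sup>+ y. ennreal (?h y) \<partial>count_space UNIV) = 1"
    by (simp only: p2_add_p2_minus ennreal_1)
  from pmf_embed_pmf[OF nn this] show ?thesis
    using assms pj by (auto simp: choice_pmf_def p_choice_pair)
qed

end

section \<open>Log-concavity and the score of a symmetric choice probability\<close>

text \<open>The mean value theorem for \<open>g1\<close>. When \<open>g1\<close> is itself a
  derivative, this is strong concavity in its monotone-gradient form.\<close>

lemma strongly_decreasing_derivative:
  fixes g1 g2 :: "real \<Rightarrow> real"
  assumes d: "\<And>x. x \<in> {l..r} \<Longrightarrow> (g1 has_real_derivative g2 x) (at x within {l..r})"
    and le: "\<And>x. x \<in> {l..r} \<Longrightarrow> g2 x \<le> - A"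
    and x: "x \<in> {l..r}" and y: "y \<in> {l..r}"
  shows "(g1 x - g1 y) * (x - y) \<le> - A * (x - y)\<^sup>2"
proof -
  have *: "(g1 x - g1 y) * (x - y) \<le> - A * (x - y)\<^sup>2"
    if xy: "x \<in> {l..r}" "y \<in> {l..r}" "x \<le> y" for x y
  proof -
    have "\<exists>z\<in>{x..y}. g1 y - g1 x = g2 z * (y - x)"
    proof (rule mvt_very_simple[OF xy(3)])
      fix z assume "x \<le> z" "z \<le> y"
      hence "(g1 has_real_derivative g2 z) (at z within {x..y})"
        using xy by (intro has_field_derivative_subset[OF d]) auto
      thus "(g1 has_derivative (*) (g2 z)) (at z within {x..y})"
        by (simp add: has_field_derivative_def)
    qed
    then obtain z where z: "z \<in> {x..y}" "g1 y - g1 x = g2 z * (y - x)" by blast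
    have "g1 x - g1 y = g2 z * (x - y)" using z(2) by (simp add: algebra_simps)
    hence "(g1 x - g1 y) * (x - y) = g2 z * (x - y)\<^sup>2" by (simp add: power2_eq_square)
    also have "\<dots> \<le> - A * (x - y)\<^sup>2"
      using le[of z] z(1) xy by (intro mult_right_mono) auto
    finally show ?thesis .
  qed
  show ?thesis using *[of x y] *[of y x] x y
    by (cases "x \<le> y") (auto simp: power2_commute algebra_simps)
qed

text \<open>If \<open>P x\<close> vanished, then \<open>P (- x) = 1\<close>, and \<open>ln P\<close> would be 0 at both \<open>x\<close> and \<open>- x\<close> (as \<open>ln 0 = 0\<close>)
  although it is concave and negative at 0.\<close>
lemma log_concave_choice_probability_pos:
  fixes P g1 g2 :: "real \<Rightarrow> real"
  assumes nonneg: "\<And>x. 0 \<le> P x" and sym: "\<And>x. P x + P (- x) = 1"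
    and d: "\<And>x. x \<in> {-c..c} \<Longrightarrow> ((\<lambda>u. ln (P u)) has_real_derivative g1 x) (at x within {-c..c})"
    and d2: "\<And>x. x \<in> {-c..c} \<Longrightarrow> (g1 has_real_derivative g2 x) (at x within {-c..c})"
    and le: "\<And>x. x \<in> {-c..c} \<Longrightarrow> g2 x \<le> 0"
    and x: "x \<in> {-c..c}"
  shows "P x > 0"
proof (rule ccontr)
  assume "\<not> P x > 0"
  hence P0: "P x = 0" using nonneg[of x] by simp
  hence P1: "P (- x) = 1" using sym[of x] by simp
  have half: "P 0 = 1 / 2" using sym[of 0] by simp
  define y where "y = \<bar>x\<bar>"
  have y: "y > 0" using P0 half by (cases "x = 0") (auto simp: y_def)
  have yc: "y \<le> c" using x by (auto simp: y_def)
  have g0: "ln (P 0) < 0" using half by simp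
  have gy: "ln (P y) = 0" "ln (P (- y)) = 0" using P0 P1 by (auto simp: y_def abs_if)
  have mvt: "\<exists>z\<in>{r..s}. ln (P s) - ln (P r) = g1 z * (s - r)" if rs: "r \<le> s" "- c \<le> r" "s \<le> c" for r s
  proof (rule mvt_very_simple[OF rs(1)])
    fix z assume "r \<le> z" "z \<le> s"
    hence "((\<lambda>u. ln (P u)) has_real_derivative g1 z) (at z within {r..s})"
      using rs by (intro has_field_derivative_subset[OF d]) auto
    thus "((\<lambda>u. ln (P u)) has_derivative (*) (g1 z)) (at z within {r..s})"
      by (simp add: has_field_derivative_def)
  qed
  obtain z1 where z1: "z1 \<in> {- y..0}" "ln (P 0) = g1 z1 * y"
    using mvt[of "- y" 0] y yc gy by auto
  obtain z2 where z2: "z2 \<in> {0..y}" "- ln (P 0) = g1 z2 * y"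
    using mvt[of 0 y] y yc gy by auto
  have "g1 z1 < 0" "g1 z2 > 0" using z1(2) z2(2) g0 y
    by (metis mult_less_0_iff not_less_iff_gr_or_eq, metis neg_0_less_iff_less zero_less_mult_pos2)
  \<comment> \<open>With constant 0 this says that \<open>g1\<close> is nonincreasing, yet it is
    negative at \<open>z1\<close> and positive at \<open>z2\<close>, and
    \<open>z1 \<le> 0 \<le> z2\<close>.\<close>
  moreover have "(g1 z2 - g1 z1) * (z2 - z1) \<le> - 0 * (z2 - z1)\<^sup>2"
    by (rule strongly_decreasing_derivative[OF d2]) (use z1 z2 yc le in auto)
  ultimately have "z2 - z1 \<le> 0" by (simp add: mult_le_0_iff)
  hence "z1 = z2" using z1(1) z2(1) by auto
  thus False using \<open>g1 z1 < 0\<close> \<open>g1 z2 > 0\<close> by simp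
qed

text \<open>Both sides are the derivative of \<open>P\<close>: the left one through
  \<open>P = exp (ln P)\<close>, the right one through \<open>P u = 1 - P (- u)\<close>. It is the
  identity that centres the score.\<close>

lemma symmetric_choice_score_balance:
  fixes P g1 :: "real \<Rightarrow> real"
  assumes sym: "\<And>x. P x + P (- x) = 1"
    and d: "\<And>x. x \<in> {-c..c} \<Longrightarrow> ((\<lambda>u. ln (P u)) has_real_derivative g1 x) (at x within {-c..c})"
    and pos: "\<And>x. x \<in> {-c..c} \<Longrightarrow> P x > 0" and c: "c > 0"
    and x: "x \<in> {-c..c}"
  shows "P x * g1 x = P (- x) * g1 (- x)"
proof -
  have dP: "(P has_real_derivative P z * g1 z) (at z within {-c..c})" if z: "z \<in> {-c..c}" for z
  proof -
    have "((\<lambda>u. exp (ln (P u))) has_real_derivative exp (ln (P z)) * g1 z) (at z within {-c..c})"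
      by (rule DERIV_chain2[OF DERIV_exp d[OF z]])
    hence "((\<lambda>u. exp (ln (P u))) has_real_derivative P z * g1 z) (at z within {-c..c})"
      using pos[OF z] by simp
    thus ?thesis
      by (rule has_field_derivative_transform_within[where d = 1]) (use pos z in auto)
  qed
  have x': "- x \<in> {-c..c}" using x by auto
  have "(uminus has_real_derivative - 1) (at x within {-c..c})"
    by (auto intro!: derivative_eq_intros)
  hence "((\<lambda>u. P (- u)) has_real_derivative - (P (- x) * g1 (- x))) (at x within {-c..c})"
    using DERIV_image_chain[of P "P (- x) * g1 (- x)" uminus x "{-c..c}" "-1"] dP[OF x']
    by (simp add: o_def)
  hence "((\<lambda>u. 1 - P (- u)) has_real_derivative P (- x) * g1 (- x)) (at x within {-c..c})"
    by (auto intro!: derivative_eq_intros)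
  moreover have "(\<lambda>u. 1 - P (- u)) = P"
  proof
    show "1 - P (- u) = P u" for u using sym[of u] by simp
  qed
  ultimately have "(P has_real_derivative P (- x) * g1 (- x)) (at x within {-c..c})" by simp
  \<comment> \<open>Derivatives within the interval are unique, also at its endpoints, because
    \<open>c > 0\<close> makes every point a limit point.\<close>
  moreover have "at x within {-c..c} \<noteq> bot"
    using c x by (simp add: trivial_limit_within islimpt_Icc)
  ultimately show ?thesis using has_field_derivative_unique dP[OF x] by blast
qed

subsection \<open>Laplacians of pair comparisons\<close>

text \<open>Coordinates of \<open>e_i - e_j\<close>, a row of the oriented incidence matrix of the
  comparison graph.\<close>

definition pair_diff :: "nat \<Rightarrow> nat \<Rightarrow> nat \<Rightarrow> real" where
  "pair_diff i j k = of_bool (k = i) - of_bool (k = j)"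

lemma sum_mult_pair_diff:
  assumes "i < n" "j < n"
  shows "(\<Sum>k<n. x k * pair_diff i j k) = x i - x j"
proof -
  have "(\<Sum>k<n. x k * pair_diff i j k) = (\<Sum>k<n. (if k = i then x k else 0) - (if k = j then x k else 0))"
    by (intro sum.cong) (auto simp: pair_diff_def)
  thus ?thesis using assms by (simp add: sum_subtractf)
qed

lemma sum_pair_diff:
  assumes "i < n" "j < n"
  shows "(\<Sum>k<n. pair_diff i j k) = 0"
  using sum_mult_pair_diff[OF assms, of "\<lambda>_. 1"] by simp

lemma sum_pair_diff_square:
  assumes "i < n" "j < n" "i \<noteq> j"
  shows "(\<Sum>k<n. (pair_diff i j k)\<^sup>2) = 2"
  using sum_mult_pair_diff[OF assms(1,2), of "pair_diff i j"] assms(3)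
  by (simp add: power2_eq_square) (simp add: pair_diff_def)

context
  fixes n m :: nat and S :: "nat \<Rightarrow> nat set" and I J :: "nat \<Rightarrow> nat"
  assumes pairs: "\<And>t. t < m \<Longrightarrow> S t = {I t, J t} \<and> I t \<noteq> J t \<and> I t < n \<and> J t < n"
    and n2: "n \<ge> 2"
begin

text \<open>For distinct \<open>k\<close> and \<open>l\<close> the product of the two entries is -1
  if the comparison is between \<open>k\<close> and \<open>l\<close>, and 0 otherwise; only
  cardinality 2 contributes to the weighted count.\<close>

lemma M_w_pairs:
  assumes kl: "k < n" "l < n"
  shows "M_w n m S (\<lambda>_. w) $$ (k, l) = (if k = l then 0
    else - (w * real n / real m) * (\<Sum>t<m. pair_diff (I t) (J t) k * pair_diff (I t) (J t) l))"
proof (cases "k = l")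
  case False
  have "mcount m S k l q = 0" if "q \<noteq> 2" for q
    using pairs that by (auto simp: mcount_def card_2_iff)
  hence "(\<Sum>q\<in>{2..n}. w * real (mcount m S k l q)) = (\<Sum>q\<in>{2..n}. if q = 2 then w * real (mcount m S k l 2) else 0)"
    by (intro sum.cong) auto
  also have "\<dots> = w * real (mcount m S k l 2)" using n2 by simp
  also have "mcount m S k l 2 = card {t \<in> {..<m}. {k, l} \<subseteq> S t}"
    unfolding mcount_def using pairs by (intro arg_cong[where f = card]) (auto simp: card_2_iff)
  also have "real (card {t \<in> {..<m}. {k, l} \<subseteq> S t}) = (\<Sum>t<m. of_bool ({k, l} \<subseteq> S t))"
    by (simp add: of_bool_def sum.If_cases Int_def)
  also have "\<dots> = (\<Sum>t<m. - (pair_diff (I t) (J t) k * pair_diff (I t) (J t) l))"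
    by (intro sum.cong refl) (use pairs False in \<open>auto simp: pair_diff_def\<close>)
  finally show ?thesis using kl False by (simp add: M_w_def sum_negf)
qed (use kl in \<open>simp add: M_w_def\<close>)

text \<open>The Laplacian is a multiple of a sum of outer products of the vectors
  \<open>pair_diff\<close>. Each outer product has zero row sums, so the degree of \<open>k\<close>
  equals the diagonal entry of that sum.\<close>

lemma laplacian_pairs:
  assumes kl: "k < n" "l < n"
  shows "laplacian (M_w n m S (\<lambda>_. w)) $$ (k, l) =
    w * real n / real m * (\<Sum>t<m. pair_diff (I t) (J t) k * pair_diff (I t) (J t) l)"
proof -
  define c where "c = w * real n / real m"
  define d where "d k l = (\<Sum>t<m. pair_diff (I t) (J t) k * pair_diff (I t) (J t) l)" for k l
  have dim: "dim_row (M_w n m S (\<lambda>_. w)) = n" "dim_col (M_w n m S (\<lambda>_. w)) = n"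
    by (simp_all add: M_w_def)
  have "(\<Sum>l<n. d k l) = (\<Sum>t<m. \<Sum>l<n. pair_diff (I t) (J t) k * pair_diff (I t) (J t) l)"
    unfolding d_def by (rule sum.swap)
  also have "\<dots> = 0"
    by (rule sum.neutral, rule ballI) (simp add: pairs sum_pair_diff sum_distrib_left[symmetric])
  finally have row: "(\<Sum>l<n. d k l) = 0" .
  have "(\<Sum>l<n. M_w n m S (\<lambda>_. w) $$ (k, l)) = (\<Sum>l<n. (- c) * d k l + (if k = l then c * d k k else 0))"
    using kl by (intro sum.cong) (auto simp: M_w_pairs c_def d_def)
  also have "\<dots> = (- c) * (\<Sum>l<n. d k l) + (\<Sum>l<n. if k = l then c * d k k else 0)"
    by (simp only: sum.distrib sum_distrib_left)
  also have "\<dots> = c * d k k" using kl row by simp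
  finally have "(\<Sum>l<n. M_w n m S (\<lambda>_. w) $$ (k, l)) = c * d k k" .
  thus ?thesis using kl
    by (auto simp: laplacian_def dim M_w_pairs c_def d_def)
qed

lemma laplacian_carrier: "laplacian (M_w n m S w) \<in> carrier_mat n n"
  by (simp add: laplacian_def M_w_def)

text \<open>The outer products turn the quadratic form into a nonnegative multiple of a sum of
  squares, so the variational bound applies.\<close>

lemma lambda_2_le_pairs:
  fixes x :: "nat \<Rightarrow> real"
  assumes w: "w \<ge> 0" and x: "(\<Sum>i<n. x i) = 0"
  shows "lambda_k 2 (laplacian (M_w n m S (\<lambda>_. w))) * (\<Sum>i<n. (x i)\<^sup>2)
    \<le> w * real n / real m * (\<Sum>t<m. (x (I t) - x (J t))\<^sup>2)"
proof -
  let ?L = "laplacian (M_w n m S (\<lambda>_. w))"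
  define c where "c = w * real n / real m"
  have quad: "(\<Sum>i<n. \<Sum>j<n. ?L $$ (i, j) * x i * x j) = c * (\<Sum>t<m. (x (I t) - x (J t))\<^sup>2)" for x
  proof -
    have "(\<Sum>i<n. \<Sum>j<n. ?L $$ (i, j) * x i * x j) =
      (\<Sum>i<n. \<Sum>j<n. \<Sum>t<m. c * ((x i * pair_diff (I t) (J t) i) * (x j * pair_diff (I t) (J t) j)))"
      by (intro sum.cong refl)
        (simp add: laplacian_pairs c_def sum_distrib_left sum_distrib_right mult_ac)
    also have "\<dots> = (\<Sum>i<n. \<Sum>t<m. \<Sum>j<n. c * ((x i * pair_diff (I t) (J t) i) * (x j * pair_diff (I t) (J t) j)))"
      by (rule sum.cong[OF refl], rule sum.swap)
    also have "\<dots> = (\<Sum>t<m. \<Sum>i<n. \<Sum>j<n. c * ((x i * pair_diff (I t) (J t) i) * (x j * pair_diff (I t) (J t) j)))"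
      by (rule sum.swap)
    also have "\<dots> = (\<Sum>t<m. c * ((\<Sum>i<n. x i * pair_diff (I t) (J t) i) * (\<Sum>j<n. x j * pair_diff (I t) (J t) j)))"
      by (simp only: sum_product) (simp only: sum_distrib_left)
    also have "\<dots> = (\<Sum>t<m. c * (x (I t) - x (J t))\<^sup>2)"
      by (intro sum.cong refl) (use pairs in \<open>simp add: sum_mult_pair_diff power2_eq_square\<close>)
    finally show ?thesis by (simp add: sum_distrib_left)
  qed
  have c: "0 \<le> c" using w by (simp add: c_def)
  have "lambda_k 2 ?L * (\<Sum>i<n. (x i)\<^sup>2) \<le> (\<Sum>i<n. \<Sum>j<n. ?L $$ (i, j) * x i * x j)"
  proof (rule lambda_2_le_quadratic_form[OF laplacian_carrier _ _ _ x])
    show "?L $$ (i, j) = ?L $$ (j, i)" if "i < n" "j < n" for i j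
      using that by (simp add: laplacian_pairs mult.commute)
    show "(\<Sum>j<n. ?L $$ (i, j)) = 0" if "i < n" for i
    proof -
      have "(\<Sum>j<n. ?L $$ (i, j)) = c * (\<Sum>j<n. \<Sum>t<m. pair_diff (I t) (J t) i * pair_diff (I t) (J t) j)"
        using that by (simp add: laplacian_pairs c_def sum_distrib_left)
      also have "(\<Sum>j<n. \<Sum>t<m. pair_diff (I t) (J t) i * pair_diff (I t) (J t) j)
        = (\<Sum>t<m. \<Sum>j<n. pair_diff (I t) (J t) i * pair_diff (I t) (J t) j)" by (rule sum.swap)
      also have "\<dots> = 0"
        by (rule sum.neutral, rule ballI) (simp add: pairs sum_pair_diff sum_distrib_left[symmetric])
      finally show ?thesis by simp
    qed
    show "0 \<le> (\<Sum>i<n. \<Sum>j<n. ?L $$ (i, j) * x i * x j)" for x :: "nat \<Rightarrow> real"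
      unfolding quad using c by (intro mult_nonneg_nonneg sum_nonneg) auto
  qed
  thus ?thesis unfolding quad c_def .
qed

text \<open>Carries the connectivity assumption, stated for weight 1, over to the weight 1/4 of the
  error bound.\<close>

lemma lambda_2_pos_scale:
  assumes "lambda_k 2 (laplacian (M_w n m S (\<lambda>_. 1))) > 0" and w: "w > 0"
  shows "lambda_k 2 (laplacian (M_w n m S (\<lambda>_. w))) > 0"
proof -
  let ?L = "laplacian (M_w n m S (\<lambda>_. 1))"
  have "laplacian (M_w n m S (\<lambda>_. w)) = w \<cdot>\<^sub>m ?L"
    using laplacian_carrier[of "\<lambda>_. w"] laplacian_carrier[of "\<lambda>_. 1"]
    by (intro eq_matI) (auto simp: laplacian_pairs)
  thus ?thesis using lambda_2_smult_pos[OF laplacian_carrier w assms(1)] by simp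
qed

end

subsection \<open>The maximum likelihood estimator\<close>

lemma deriv_nonpos_of_right_max:
  fixes \<phi> :: "real \<Rightarrow> real"
  assumes d: "(\<phi> has_real_derivative D) (at 0 within {0..1})"
    and max: "\<And>s. s \<in> {0..1} \<Longrightarrow> \<phi> s \<le> \<phi> 0"
  shows "D \<le> 0"
proof (rule tendsto_upperbound)
  show "((\<lambda>s. (\<phi> s - \<phi> 0) / (s - 0)) \<longlongrightarrow> D) (at 0 within {0..1})"
    using d by (simp add: has_field_derivative_iff)
  show "\<forall>\<^sub>F s in at 0 within {0..1}. (\<phi> s - \<phi> 0) / (s - 0) \<le> 0"
    unfolding eventually_at_filter using max
    by (intro always_eventually) (auto simp: divide_le_0_iff)
  show "at 0 within {0..1::real} \<noteq> bot"
    by (simp add: trivial_limit_within islimpt_Icc)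
qed

text \<open>Moving from the maximiser \<open>z\<close> towards \<open>x\<close> cannot increase the
  objective, so its one-sided derivative there is nonpositive, even if \<open>z\<close> lies on the
  boundary. Strong monotonicity of \<open>g1\<close> then replaces the slopes at \<open>z\<close> by
  those at \<open>x\<close>.\<close>

lemma segment_maximizer_score_bound:
  fixes g g1 g2 :: "real \<Rightarrow> real" and z x :: "nat \<Rightarrow> real"
  assumes d: "\<And>v. v \<in> {l..r} \<Longrightarrow> (g has_real_derivative g1 v) (at v within {l..r})"
    and d2: "\<And>v. v \<in> {l..r} \<Longrightarrow> (g1 has_real_derivative g2 v) (at v within {l..r})"
    and le: "\<And>v. v \<in> {l..r} \<Longrightarrow> g2 v \<le> - A"
    and z: "\<And>t. t < m \<Longrightarrow> z t \<in> {l..r}" and x: "\<And>t. t < m \<Longrightarrow> x t \<in> {l..r}"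
    and max: "\<And>s. s \<in> {0..1} \<Longrightarrow> (\<Sum>t<m. g (z t + s * (x t - z t))) \<le> (\<Sum>t<m. g (z t))"
  shows "A * (\<Sum>t<m. (z t - x t)\<^sup>2) \<le> (\<Sum>t<m. g1 (x t) * (z t - x t))"
proof -
  have "((\<lambda>s. \<Sum>t<m. g (z t + s * (x t - z t))) has_real_derivative (\<Sum>t<m. g1 (z t) * (x t - z t)))
      (at 0 within {0..1})"
  proof (rule DERIV_sum)
    fix t assume "t \<in> {..<m}"
    hence t: "t < m" by simp
    define h where "h s = z t + s * (x t - z t)" for s
    have "h ` {0..1} \<subseteq> {l..r}"
    proof safe
      fix s :: real assume s: "s \<in> {0..1}"
      have "h s = (1 - s) *\<^sub>R z t + s *\<^sub>R x t" by (simp add: h_def algebra_simps)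
      also have "\<dots> \<in> {l..r}"
        by (rule convexD) (use s z[OF t] x[OF t] in auto)
      finally show "h s \<in> {l..r}" .
    qed
    hence "(g has_real_derivative g1 (z t)) (at (h 0) within h ` {0..1})"
      using d[OF z[OF t]] by (simp add: h_def has_field_derivative_subset)
    moreover have "(h has_real_derivative (x t - z t)) (at 0 within {0..1})"
      unfolding h_def by (auto intro!: derivative_eq_intros)
    ultimately have "(g \<circ> h has_real_derivative g1 (z t) * (x t - z t)) (at 0 within {0..1})"
      by (rule DERIV_image_chain)
    thus "((\<lambda>s. g (z t + s * (x t - z t))) has_real_derivative g1 (z t) * (x t - z t)) (at 0 within {0..1})"
      by (simp add: o_def h_def)
  qed
  from deriv_nonpos_of_right_max[OF this] max
  have "(\<Sum>t<m. g1 (z t) * (x t - z t)) \<le> 0" by simp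
  moreover have "(\<Sum>t<m. (g1 (z t) - g1 (x t)) * (z t - x t)) \<le> (\<Sum>t<m. - A * (z t - x t)\<^sup>2)"
    using z x by (intro sum_mono strongly_decreasing_derivative[OF d2 le]) auto
  moreover have "(\<Sum>t<m. (g1 (z t) - g1 (x t)) * (z t - x t)) =
      - (\<Sum>t<m. g1 (z t) * (x t - z t)) - (\<Sum>t<m. g1 (x t) * (z t - x t))"
    by (simp add: sum_negf[symmetric] sum_subtractf[symmetric] algebra_simps)
  moreover have "(\<Sum>t<m. - A * (z t - x t)\<^sup>2) = - (A * (\<Sum>t<m. (z t - x t)\<^sup>2))"
    by (simp add: sum_distrib_left sum_negf)
  ultimately show ?thesis by linarith
qed

lemma Theta_segment:
  assumes "\<theta> \<in> Theta n b" "\<theta>' \<in> Theta n b" "s \<in> {0..1}"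
  shows "(\<lambda>i. \<theta> i + s * (\<theta>' i - \<theta> i)) \<in> Theta n b"
proof -
  have "\<bar>\<theta> i + s * (\<theta>' i - \<theta> i)\<bar> \<le> b" if "i < n" for i
  proof -
    have "(1 - s) *\<^sub>R \<theta> i + s *\<^sub>R \<theta>' i \<in> {-b..b}"
      by (rule convexD) (use assms that in \<open>auto simp: Theta_def abs_le_iff minus_le_iff\<close>)
    thus ?thesis by (auto simp: algebra_simps abs_le_iff)
  qed
  thus ?thesis using assms
    by (auto simp: Theta_def sum.distrib sum_distrib_left[symmetric] sum_subtractf)
qed

section \<open>Error bound for the maximum likelihood estimator\<close>

theorem theorem1:
  fixes F f :: "real \<Rightarrow> real" and n m :: nat and b A B :: real
    and S :: "nat \<Rightarrow> nat set" and \<theta>star :: "nat \<Rightarrow> real"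
  assumes noise: "thurstone_noise F f"
    and n2: "n \<ge> 2" and m1: "m \<ge> 1" and b_pos: "b > 0"
    and theta_star: "\<theta>star \<in> Theta n b"
    and S_sub: "\<forall>t<m. S t \<subseteq> {..<n}"
    and S_card: "\<forall>t<m. card (S t) = 2"
    and A_pos: "A > 0" and B_pos: "B > 0"
    and P12: "\<exists>g1 g2. \<forall>x\<in>{-2*b..2*b}.
                ((\<lambda>u. ln (p2 F f u)) has_real_derivative g1 x) (at x within {-2*b..2*b}) \<and>
                (g1 has_real_derivative g2 x) (at x within {-2*b..2*b}) \<and>
                g2 x \<le> - A \<and> \<bar>g1 x\<bar> \<le> B"
    and P3: "lambda_k 2 (laplacian (M_w n m S (\<lambda>_. 1))) > 0"
  shows "measure_pmf.prob (choices_pmf F f \<theta>star m S)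
           {y. \<forall>\<theta>hat. \<theta>hat \<in> Theta n b \<and> (\<forall>\<theta>\<in>Theta n b. loglik F f m S y \<theta> \<le> loglik F f m S y \<theta>hat)
                 \<longrightarrow> MSE n \<theta>hat \<theta>star \<le>
                     (B / A)\<^sup>2 * (real n * (ln (real n) + 2)
                       / (lambda_k 2 (laplacian (M_w n m S (\<lambda>_. 1/4))))\<^sup>2) * (1 / real m)}
         \<ge> 1 - 2 / real n"
proof -
  obtain g1 g2 where g: "\<And>x. x \<in> {-(2*b)..2*b} \<Longrightarrow> ((\<lambda>u. ln (p2 F f u)) has_real_derivative g1 x) (at x within {-(2*b)..2*b})"
    "\<And>x. x \<in> {-(2*b)..2*b} \<Longrightarrow> (g1 has_real_derivative g2 x) (at x within {-(2*b)..2*b})"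
    "\<And>x. x \<in> {-(2*b)..2*b} \<Longrightarrow> g2 x \<le> - A" "\<And>x. x \<in> {-(2*b)..2*b} \<Longrightarrow> \<bar>g1 x\<bar> \<le> B"
    using P12 by (auto simp del: atLeastAtMost_iff)
  note sym = p2_add_p2_minus[OF noise]
  have g2_nonpos: "g2 x \<le> 0" if "x \<in> {-(2*b)..2*b}" for x using g(3)[OF that] A_pos by simp
  have pos: "p2 F f x > 0" if "x \<in> {-(2*b)..2*b}" for x
    by (rule log_concave_choice_probability_pos[OF p2_nonneg[OF noise] sym g(1,2) g2_nonpos that])
  have balance: "p2 F f x * g1 x = p2 F f (- x) * g1 (- x)" if "x \<in> {-(2*b)..2*b}" for x
    by (rule symmetric_choice_score_balance[OF sym g(1) pos _ that]) (use b_pos in auto)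
  have "\<forall>t. \<exists>i j. t < m \<longrightarrow> S t = {i, j} \<and> i \<noteq> j \<and> i < n \<and> j < n"
    using S_sub S_card by (fastforce simp: card_2_iff)
  then obtain I J where IJ: "\<And>t. t < m \<Longrightarrow> S t = {I t, J t} \<and> I t \<noteq> J t \<and> I t < n \<and> J t < n"
    by metis
  define lam where "lam = lambda_k 2 (laplacian (M_w n m S (\<lambda>_. 1/4)))"
  have lam: "lam > 0" unfolding lam_def
    by (rule lambda_2_pos_scale[OF IJ n2 P3]) auto
  \<comment> \<open>The sign orients the difference towards the chosen item; \<xi> is then the
    derivative of the log-likelihood of comparison \<open>t\<close> in
    \<open>\<theta> (I t) - \<theta> (J t)\<close> at the true parameter.\<close>
  define \<sigma> where "\<sigma> t y = (if y = I t then 1 else - 1 :: real)" for t y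
  define \<xi> where "\<xi> t y = \<sigma> t y * g1 (\<sigma> t y * (\<theta>star (I t) - \<theta>star (J t)))" for t y
  define G where "G y = (\<Sum>k<n. (\<Sum>t<m. \<xi> t (y t) * pair_diff (I t) (J t) k)\<^sup>2)" for y
  \<comment> \<open>The tail bound with \<open>c = 2\<close>, the squared length of
    \<open>pair_diff\<close>, and \<open>s = 2 * (ln (real n) + 2)\<close>. The 16 later cancels
    against the square of the 4 that comes from the weight 1/4.\<close>
  define R where "R = 16 * real m * B\<^sup>2 * (ln (real n) + 2)"
  have diff_in: "\<theta> (I t) - \<theta> (J t) \<in> {-(2*b)..2*b}" "\<sigma> t y * (\<theta> (I t) - \<theta> (J t)) \<in> {-(2*b)..2*b}"
    if "\<theta> \<in> Theta n b" "t < m" for \<theta> t y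
  proof -
    have "\<bar>\<theta> (I t)\<bar> \<le> b" "\<bar>\<theta> (J t)\<bar> \<le> b" using that IJ[OF that(2)] by (auto simp: Theta_def)
    thus "\<theta> (I t) - \<theta> (J t) \<in> {-(2*b)..2*b}" "\<sigma> t y * (\<theta> (I t) - \<theta> (J t)) \<in> {-(2*b)..2*b}"
      by (auto simp: \<sigma>_def abs_le_iff)
  qed
  let ?P = "choices_pmf F f \<theta>star m S"
  have tail: "measure_pmf.prob ?P {y. G y > R} \<le> 2 / real n"
  proof -
    have "measure_pmf.prob (Pi_pmf {..<m} 0 (\<lambda>t. choice_pmf F f \<theta>star (S t)))
      {y. (\<Sum>k<n. (\<Sum>t<m. \<xi> t (y t) * pair_diff (I t) (J t) k)\<^sup>2) > 4 * 2 * B\<^sup>2 * real m * (2 * (ln (real n) + 2))}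
      \<le> exp (1 / 2 - 2 * (ln (real n) + 2))"
    proof (rule sq_norm_sum_tail_bound)
      fix t assume t: "t < m"
      note I = IJ[OF t]
      show "\<bar>\<xi> t y\<bar> \<le> B" for y
      proof -
        have "\<bar>\<sigma> t y\<bar> = 1" by (simp add: \<sigma>_def)
        thus ?thesis using g(4)[OF diff_in(2)[OF theta_star t, of y]] by (simp add: \<xi>_def abs_mult)
      qed
      show "(\<Sum>k<n. (pair_diff (I t) (J t) k)\<^sup>2) \<le> 2" using I by (simp add: sum_pair_diff_square)
      have pmf: "pmf (choice_pmf F f \<theta>star (S t)) y = (if y = I t then p2 F f (\<theta>star (I t) - \<theta>star (J t))
          else if y = J t then p2 F f (- (\<theta>star (I t) - \<theta>star (J t))) else 0)" for y
        using I pmf_choice_pair[OF noise, of "I t" "J t" \<theta>star y] by simp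
      have "measure_pmf.expectation (choice_pmf F f \<theta>star (S t)) (\<xi> t)
        = (\<Sum>y\<in>{I t, J t}. pmf (choice_pmf F f \<theta>star (S t)) y *\<^sub>R \<xi> t y)"
        by (rule integral_measure_pmf) (auto simp: set_pmf_iff pmf split: if_splits)
      \<comment> \<open>With \<open>d\<close> the true difference the mean is
        \<open>p2 F f d * g1 d - p2 F f (- d) * g1 (- d)\<close>, zero by
        \<open>balance\<close>.\<close>
      also have "\<dots> = 0"
        using conjunct1[OF conjunct2[OF I]] balance[OF diff_in(1)[OF theta_star t]]
        by (simp add: pmf \<xi>_def \<sigma>_def)
      finally show "measure_pmf.expectation (choice_pmf F f \<theta>star (S t)) (\<xi> t) = 0" .
    qed (use B_pos m1 in auto)
    also have "exp (1 / 2 - 2 * (ln (real n) + 2)) \<le> exp (- ln (real n))"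
    proof -
      have "1 / 2 - 2 * (x + 2) \<le> - x" if "0 \<le> x" for x :: real using that by simp
      from this[of "ln (real n)"] show ?thesis using n2 by simp
    qed
    also have "\<dots> = 1 / real n" using n2 by (simp add: exp_minus inverse_eq_divide)
    also have "\<dots> \<le> 2 / real n" by (simp add: divide_right_mono)
    also have "4 * 2 * B\<^sup>2 * real m * (2 * (ln (real n) + 2)) = R" by (simp add: R_def)
    finally show ?thesis by (simp add: choices_pmf_def G_def)
  qed
  have good: "MSE n \<theta>hat \<theta>star \<le> (B / A)\<^sup>2 * (real n * (ln (real n) + 2) / lam\<^sup>2) * (1 / real m)"
    if y: "\<And>t. t < m \<Longrightarrow> y t \<in> S t" and Gy: "G y \<le> R" and hat: "\<theta>hat \<in> Theta n b"
      and mle: "\<And>\<theta>. \<theta> \<in> Theta n b \<Longrightarrow> loglik F f m S y \<theta> \<le> loglik F f m S y \<theta>hat" for y \<theta>hat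
  proof -
    \<comment> \<open>As \<open>y t\<close> is one of the two items, the sign selects the right one
      of the two probabilities.\<close>
    have loglik: "loglik F f m S y \<theta> = (\<Sum>t<m. ln (p2 F f (\<sigma> t (y t) * (\<theta> (I t) - \<theta> (J t)))))" for \<theta>
      unfolding loglik_def
    proof (rule sum.cong[OF refl])
      fix t assume "t \<in> {..<m}"
      hence t: "t < m" by simp
      note I = IJ[OF t]
      have "y t = I t \<or> y t = J t" using y[OF t] I by auto
      thus "ln (p_choice F f \<theta> (y t) (S t)) = ln (p2 F f (\<sigma> t (y t) * (\<theta> (I t) - \<theta> (J t))))"
        using I p_choice_pair[OF noise, of "I t" "J t" \<theta>] p_choice_pair[OF noise, of "J t" "I t" \<theta>]
        by (auto simp: \<sigma>_def insert_commute)
    qed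
    define \<Delta> where "\<Delta> k = \<theta>hat k - \<theta>star k" for k
    define N where "N = (\<Sum>k<n. (\<Delta> k)\<^sup>2)"
    define H where "H = (\<Sum>k<n. (\<Sum>t<m. \<xi> t (y t) * pair_diff (I t) (J t) k) * \<Delta> k)"
    have "A * (\<Sum>t<m. (\<sigma> t (y t) * (\<theta>hat (I t) - \<theta>hat (J t)) - \<sigma> t (y t) * (\<theta>star (I t) - \<theta>star (J t)))\<^sup>2)
      \<le> (\<Sum>t<m. g1 (\<sigma> t (y t) * (\<theta>star (I t) - \<theta>star (J t))) *
          (\<sigma> t (y t) * (\<theta>hat (I t) - \<theta>hat (J t)) - \<sigma> t (y t) * (\<theta>star (I t) - \<theta>star (J t))))"
    proof (rule segment_maximizer_score_bound[OF g(1-3) diff_in(2)[OF hat] diff_in(2)[OF theta_star]])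
      fix s :: real assume "s \<in> {0..1}"
      from mle[OF Theta_segment[OF hat theta_star this]]
      show "(\<Sum>t<m. ln (p2 F f (\<sigma> t (y t) * (\<theta>hat (I t) - \<theta>hat (J t)) + s *
            (\<sigma> t (y t) * (\<theta>star (I t) - \<theta>star (J t)) - \<sigma> t (y t) * (\<theta>hat (I t) - \<theta>hat (J t))))))
          \<le> (\<Sum>t<m. ln (p2 F f (\<sigma> t (y t) * (\<theta>hat (I t) - \<theta>hat (J t)))))"
        unfolding loglik by (simp add: algebra_simps)
    qed
    also have "(\<Sum>t<m. (\<sigma> t (y t) * (\<theta>hat (I t) - \<theta>hat (J t)) - \<sigma> t (y t) * (\<theta>star (I t) - \<theta>star (J t)))\<^sup>2)
        = (\<Sum>t<m. (\<Delta> (I t) - \<Delta> (J t))\<^sup>2)"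
      by (intro sum.cong refl)
        (auto simp: \<Delta>_def \<sigma>_def power2_eq_square algebra_simps)
    also have "(\<Sum>t<m. g1 (\<sigma> t (y t) * (\<theta>star (I t) - \<theta>star (J t))) *
          (\<sigma> t (y t) * (\<theta>hat (I t) - \<theta>hat (J t)) - \<sigma> t (y t) * (\<theta>star (I t) - \<theta>star (J t))))
        = (\<Sum>t<m. \<xi> t (y t) * (\<Delta> (I t) - \<Delta> (J t)))"
      by (intro sum.cong refl) (simp add: \<Delta>_def \<xi>_def algebra_simps)
    also have "\<dots> = (\<Sum>t<m. \<Sum>k<n. \<xi> t (y t) * pair_diff (I t) (J t) k * \<Delta> k)"
    proof (rule sum.cong[OF refl])
      fix t assume "t \<in> {..<m}"
      hence "\<Delta> (I t) - \<Delta> (J t) = (\<Sum>k<n. \<Delta> k * pair_diff (I t) (J t) k)"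
        using IJ by (simp add: sum_mult_pair_diff)
      thus "\<xi> t (y t) * (\<Delta> (I t) - \<Delta> (J t)) = (\<Sum>k<n. \<xi> t (y t) * pair_diff (I t) (J t) k * \<Delta> k)"
        by (simp add: sum_distrib_left mult_ac)
    qed
    also have "\<dots> = H"
      unfolding H_def sum_distrib_right by (rule sum.swap)
    finally have score: "A * (\<Sum>t<m. (\<Delta> (I t) - \<Delta> (J t))\<^sup>2) \<le> H" .
    \<comment> \<open>Both parameters sum to 0, so the error is orthogonal to the constants and the
      spectral bound applies.\<close>
    have "(\<Sum>k<n. \<Delta> k) = 0" using hat theta_star by (simp add: \<Delta>_def sum_subtractf Theta_def)
    from lambda_2_le_pairs[where w = "1/4", OF IJ n2 _ this]
    have "lam * N \<le> 1/4 * real n / real m * (\<Sum>t<m. (\<Delta> (I t) - \<Delta> (J t))\<^sup>2)"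
      by (simp add: lam_def N_def)
    hence "4 * real m * lam * N \<le> real n * (\<Sum>t<m. (\<Delta> (I t) - \<Delta> (J t))\<^sup>2)"
      using m1 by (simp add: field_simps)
    hence "A * (4 * real m * lam * N) \<le> A * (real n * (\<Sum>t<m. (\<Delta> (I t) - \<Delta> (J t))\<^sup>2))"
      using A_pos by (intro mult_left_mono) auto
    also have "\<dots> = real n * (A * (\<Sum>t<m. (\<Delta> (I t) - \<Delta> (J t))\<^sup>2))" by (simp add: mult_ac)
    also have "\<dots> \<le> real n * H" using score by (intro mult_left_mono) auto
    finally have lower: "A * (4 * real m * lam * N) \<le> real n * H" .
    have N: "0 \<le> N" by (simp add: N_def sum_nonneg)
    have "H\<^sup>2 \<le> G y * N" unfolding H_def G_def N_def by (rule Cauchy_Schwarz_ineq_sum)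
    also have "\<dots> \<le> R * N" using Gy N by (rule mult_right_mono)
    finally have H: "H\<^sup>2 \<le> R * N" .
    have "(A * (4 * real m * lam * N))\<^sup>2 \<le> (real n * H)\<^sup>2"
      using lower A_pos lam N by (intro power_mono) auto
    also have "\<dots> \<le> (real n)\<^sup>2 * (R * N)" using H by (simp add: power_mult_distrib mult_left_mono)
    finally have "(16 * A\<^sup>2 * (real m)\<^sup>2 * lam\<^sup>2 * N) * N \<le> ((real n)\<^sup>2 * R) * N"
      by (simp add: power2_eq_square mult_ac)
    moreover have "0 \<le> R" using n2 by (simp add: R_def)
    \<comment> \<open>One factor \<open>N\<close> cancels; if \<open>N = 0\<close>, the left-hand
      side is 0 and \<open>R\<close> is nonnegative.\<close>
    ultimately have "16 * A\<^sup>2 * (real m)\<^sup>2 * lam\<^sup>2 * N \<le> (real n)\<^sup>2 * R"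
      using N by (cases "N = 0") (auto simp: mult_le_cancel_right)
    hence "real m * (A\<^sup>2 * real m * lam\<^sup>2 * N) \<le> real m * ((real n)\<^sup>2 * (B\<^sup>2 * (ln (real n) + 2)))"
      by (simp add: R_def power2_eq_square algebra_simps)
    hence "A\<^sup>2 * real m * lam\<^sup>2 * N \<le> (real n)\<^sup>2 * (B\<^sup>2 * (ln (real n) + 2))"
      using m1 by (simp add: mult_le_cancel_left)
    hence "N / real n \<le> B\<^sup>2 * (real n * (ln (real n) + 2)) / (A\<^sup>2 * lam\<^sup>2 * real m)"
      using m1 n2 A_pos lam by (simp add: divide_simps power2_eq_square mult_ac)
    also have "\<dots> = (B / A)\<^sup>2 * (real n * (ln (real n) + 2) / lam\<^sup>2) * (1 / real m)"
      by (simp add: power_divide)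
    finally show ?thesis by (simp add: MSE_def N_def \<Delta>_def)
  qed
  have supp: "y t \<in> S t" if "y \<in> set_pmf ?P" "t < m" for y t
  proof -
    have "y t \<in> set_pmf (choice_pmf F f \<theta>star (S t))"
      using that by (auto simp: choices_pmf_def set_Pi_pmf PiE_dflt_def)
    thus ?thesis using IJ[OF that(2)] pmf_choice_pair[OF noise, of "I t" "J t" \<theta>star "y t"]
      by (auto simp: set_pmf_iff split: if_splits)
  qed
  let ?E = "{y. \<forall>\<theta>hat. \<theta>hat \<in> Theta n b \<and> (\<forall>\<theta>\<in>Theta n b. loglik F f m S y \<theta> \<le> loglik F f m S y \<theta>hat)
      \<longrightarrow> MSE n \<theta>hat \<theta>star \<le> (B / A)\<^sup>2 * (real n * (ln (real n) + 2) / lam\<^sup>2) * (1 / real m)}"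
  have "1 - 2 / real n \<le> 1 - measure_pmf.prob ?P {y. G y > R}" using tail by simp
  also have "\<dots> = measure_pmf.prob ?P (- {y. G y > R})"
    by (simp add: measure_pmf.prob_compl[symmetric] Compl_eq_Diff_UNIV)
  \<comment> \<open>The inclusion of events is an almost sure one: \<open>y t\<close> lies in
    \<open>S t\<close> on the support. On the good event the bound holds for every maximiser at
    once.\<close>
  also have "\<dots> \<le> measure_pmf.prob ?P ?E"
  proof (rule measure_pmf.finite_measure_mono_AE)
    show "AE y in measure_pmf ?P. y \<in> - {y. G y > R} \<longrightarrow> y \<in> ?E"
      unfolding AE_measure_pmf_iff
    proof (intro ballI impI CollectI allI)
      fix y \<theta>hat
      assume "y \<in> set_pmf ?P" "y \<in> - {y. G y > R}" and "\<theta>hat \<in> Theta n b \<and>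
        (\<forall>\<theta>\<in>Theta n b. loglik F f m S y \<theta> \<le> loglik F f m S y \<theta>hat)"
      thus "MSE n \<theta>hat \<theta>star \<le> (B / A)\<^sup>2 * (real n * (ln (real n) + 2) / lam\<^sup>2) * (1 / real m)"
        by (intro good[OF supp]) auto
    qed
  qed simp
  finally show ?thesis by (simp add: lam_def)
qed

end
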